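(* Let $A$ be a unital simple C*-algebra, $\Gamma$ a countable discrete group, and $\alpha:\Gamma\to\mathrm{Aut}(A)$ an outer action. Consider the associated C*-discrete inclusion $A\overset{E}{\subset}A\rtimes_{r,\alpha}\Gamma=:B$. Then there is an equivalence (bijective correspondence) $$\left\{{}_AX_A\ \middle|\ X\subset B\text{ is a replete and } \|\cdot\|_B\text{-closed } A\text{-}A\text{ bimodule}\right\}\ \cong\ \left\{\mathcal{L}\ \text{a right } A\text{-}A \text{ C*-correspondence}\ \middle|\ \mathcal{B}\cong\mathcal{L}\oplus\mathcal{L}^\perp\right\},$$ where the right-hand side is the set of orthogonally complemented right $A$-$A$ C*-subcorrespondences $\mathcal{L}$ of $\mathcal{B}$.
   Context: A right $A$-$A$ C*-correspondence is a right Hilbert $A$-module with a left action of $A$ by adjointable operators. $E:B\twoheadrightarrow A$ is the canonical faithful conditional expectation on the reduced crossed product, and $\mathcal B$ is the right Hilbert $A$-module completion of $B$ under $\langle b_1\mid b_2\rangle_A=E(b_1^*b_2)$, with left $A$-action (indeed left $B$-action) by left multiplication. Let $\{u_g\}_{g\in\Gamma}\subset B$ be the canonical unitaries implementing $\alpha$. An action $\alpha$ is outer if the bimodules ${}_gA$ ($A$ with $a\rhd\xi\lhd c=\alpha_{g^{-1}}(a)\xi c$) are pairwise non-isomorphic for distinct $g\in\Gamma$; equivalently $\alpha_g$ is not inner for $g\ne e$. For $x\in B$ set $\mathrm{supp}(x)=\{g\in\Gamma\mid E(xu_g^{-1})\ne0\}$, and for a subspace $X\subseteq B$ set $\mathrm{supp}(X)=\bigcup_{x\in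 X}\mathrm{supp}(x)$. $X$ is replete if it contains every $y\in B$ with $\mathrm{supp}(y)\subseteq\mathrm{supp}(X)$. C*-discreteness of $A\overset{E}{\subset}B$ means that the set of $b\in B$ whose image in $\mathcal B$ lies in a finitely generated projective (dualizable) $A$-$A$ sub-bimodule of $\mathcal B$ contained in the image of $B$ is norm-dense in $B$. *)

theory Defs
  imports
    "HOL-Analysis.Analysis"
    "HOL-Library.Function_Algebras"
    "HOL-Library.Countable"
begin

section \<open>Unital C*-algebras\<close>

class scaleC =
  fixes scaleC :: "complex \<Rightarrow> 'a \<Rightarrow> 'a"  (infixr "*\<^sub>C" 75)

class complex_banach = banach + scaleC +
  assumes scaleC_add_right: "c *\<^sub>C (x + y) = c *\<^sub>C x + c *\<^sub>C y"
    and scaleC_add_left: "(c + d) *\<^sub>C x = c *\<^sub>C x + d *\<^sub>C x"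
    and scaleC_scaleC: "c *\<^sub>C (d *\<^sub>C x) = (c * d) *\<^sub>C x"
    and scaleR_scaleC: "r *\<^sub>R x = complex_of_real r *\<^sub>C x"
    and norm_scaleC: "norm (c *\<^sub>C x) = cmod c * norm x"

class unital_cstar_algebra = complex_banach + real_normed_algebra_1 +
  fixes star :: "'a \<Rightarrow> 'a"
  assumes scaleC_mult_left: "(c *\<^sub>C x) * y = c *\<^sub>C (x * y)"
    and scaleC_mult_right: "x * (c *\<^sub>C y) = c *\<^sub>C (x * y)"
    and star_add: "star (x + y) = star x + star y"
    and star_scaleC: "star (c *\<^sub>C x) = cnj c *\<^sub>C star x"
    and star_mult: "star (x * y) = star y * star x"
    and star_star: "star (star x) = x"
    and cstar_identity: "norm (star x * x) = (norm x)\<^sup>2"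

definition closed_ideal :: "'a::unital_cstar_algebra set \<Rightarrow> bool" where
  "closed_ideal I \<longleftrightarrow> closed I \<and> 0 \<in> I \<and> (\<forall>x\<in>I. \<forall>y\<in>I. x + y \<in> I) \<and>
     (\<forall>x\<in>I. \<forall>a. a * x \<in> I \<and> x * a \<in> I)"

definition simple_cstar :: "'a::unital_cstar_algebra itself \<Rightarrow> bool" where
  "simple_cstar _ \<longleftrightarrow> (\<forall>I :: 'a set. closed_ideal I \<longrightarrow> I = {0} \<or> I = UNIV)"

definition complex_subspace :: "'v::{comm_monoid_add, scaleC} set \<Rightarrow> bool" where
  "complex_subspace X \<longleftrightarrow> 0 \<in> X \<and> (\<forall>x\<in>X. \<forall>y\<in>X. x + y \<in> X) \<and> (\<forall>x\<in>X. \<forall>c. c *\<^sub>C x \<in> X)"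


section \<open>Outer actions\<close>

text \<open>The group is a type of class \<open>group_add\<close>, which does not assume commutativity: the product
  \<open>g h\<close> is written \<open>g + h\<close>, the unit \<open>e\<close> is \<open>0\<close> and the inverse of \<open>g\<close> is \<open>- g\<close>.\<close>

definition star_automorphism :: "('a::unital_cstar_algebra \<Rightarrow> 'a) \<Rightarrow> bool" where
  "star_automorphism \<phi> \<longleftrightarrow> bij \<phi> \<and> (\<forall>x y. \<phi> (x + y) = \<phi> x + \<phi> y) \<and>
     (\<forall>c x. \<phi> (c *\<^sub>C x) = c *\<^sub>C \<phi> x) \<and> (\<forall>x y. \<phi> (x * y) = \<phi> x * \<phi> y) \<and>
     (\<forall>x. \<phi> (star x) = star (\<phi> x))"

definition cstar_action :: "('g::group_add \<Rightarrow> 'a::unital_cstar_algebra \<Rightarrow> 'a) \<Rightarrow> bool" where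
  "cstar_action \<alpha> \<longleftrightarrow> (\<forall>g. star_automorphism (\<alpha> g)) \<and> (\<forall>g h. \<alpha> (g + h) = \<alpha> g \<circ> \<alpha> h)"

text \<open>Isomorphism of \<open>\<^sub>gA\<close> and \<open>\<^sub>hA\<close> as right C*-correspondences, where \<open>\<^sub>gA\<close> is \<open>A\<close> with the
  bimodule structure \<open>a \<rhd> \<xi> \<lhd> c = \<alpha>\<^bsub>- g\<^esub>(a) \<xi> c\<close> and the inner product \<open>\<langle>\<xi> | \<eta>\<rangle> = \<xi>\<^sup>* \<eta>\<close>.\<close>

definition twisted_bimodules_isomorphic ::
    "('g::group_add \<Rightarrow> 'a::unital_cstar_algebra \<Rightarrow> 'a) \<Rightarrow> 'g \<Rightarrow> 'g \<Rightarrow> bool" where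
  "twisted_bimodules_isomorphic \<alpha> g h \<longleftrightarrow>
     (\<exists>\<phi> :: 'a \<Rightarrow> 'a. bij \<phi> \<and> (\<forall>x y. \<phi> (x + y) = \<phi> x + \<phi> y) \<and> (\<forall>c x. \<phi> (c *\<^sub>C x) = c *\<^sub>C \<phi> x) \<and>
        (\<forall>a x c. \<phi> (\<alpha> (- g) a * x * c) = \<alpha> (- h) a * \<phi> x * c) \<and>
        (\<forall>x y. star (\<phi> x) * \<phi> y = star x * y))"

definition outer_action :: "('g::group_add \<Rightarrow> 'a::unital_cstar_algebra \<Rightarrow> 'a) \<Rightarrow> bool" where
  "outer_action \<alpha> \<longleftrightarrow> (\<forall>g h. g \<noteq> h \<longrightarrow> \<not> twisted_bimodules_isomorphic \<alpha> g h)"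


section \<open>The Hilbert module of square-summable functions and its operators\<close>

definition l2 :: "('g \<Rightarrow> 'a::unital_cstar_algebra) set" where
  "l2 = {\<xi>. (\<lambda>g. star (\<xi> g) * \<xi> g) summable_on UNIV}"

definition l2_ip :: "('g \<Rightarrow> 'a::unital_cstar_algebra) \<Rightarrow> ('g \<Rightarrow> 'a) \<Rightarrow> 'a" where
  "l2_ip \<xi> \<eta> = (\<Sum>\<^sub>\<infinity>g. star (\<xi> g) * \<eta> g)"

definition l2_norm :: "('g \<Rightarrow> 'a::unital_cstar_algebra) \<Rightarrow> real" where
  "l2_norm \<xi> = sqrt (norm (l2_ip \<xi> \<xi>))"

text \<open>Operators on \<open>l2\<close> are total functions that vanish outside \<open>l2\<close>, so that equality of
  operators is equality of functions. Sums, differences and scalar multiples of operators are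
  pointwise.\<close>

type_synonym ('g, 'a) l2_op = "('g \<Rightarrow> 'a) \<Rightarrow> ('g \<Rightarrow> 'a)"

instantiation "fun" :: (type, scaleC) scaleC
begin

definition scaleC_fun :: "complex \<Rightarrow> ('a \<Rightarrow> 'b) \<Rightarrow> ('a \<Rightarrow> 'b)" where
  "scaleC_fun c f = (\<lambda>x. c *\<^sub>C f x)"

instance ..

end

definition l2_map :: "('g, 'a::unital_cstar_algebra) l2_op \<Rightarrow> bool" where
  "l2_map T \<longleftrightarrow> (\<forall>\<xi>\<in>l2. T \<xi> \<in> l2) \<and> (\<forall>\<xi>. \<xi> \<notin> l2 \<longrightarrow> T \<xi> = 0)"

definition is_l2_adjoint ::
    "('g, 'a::unital_cstar_algebra) l2_op \<Rightarrow> ('g, 'a) l2_op \<Rightarrow> bool" where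
  "is_l2_adjoint T S \<longleftrightarrow> l2_map S \<and> (\<forall>\<xi>\<in>l2. \<forall>\<eta>\<in>l2. l2_ip (T \<xi>) \<eta> = l2_ip \<xi> (S \<eta>))"

definition l2_adj :: "('g, 'a::unital_cstar_algebra) l2_op \<Rightarrow> ('g, 'a) l2_op" where
  "l2_adj T = (THE S. is_l2_adjoint T S)"

definition op_bounds :: "('g, 'a::unital_cstar_algebra) l2_op \<Rightarrow> real set" where
  "op_bounds T = {c. 0 \<le> c \<and> (\<forall>\<xi>\<in>l2. l2_norm (T \<xi>) \<le> c * l2_norm \<xi>)}"

definition op_norm :: "('g, 'a::unital_cstar_algebra) l2_op \<Rightarrow> real" where
  "op_norm T = Inf (op_bounds T)"

text \<open>Linearity over \<open>A\<close> follows from adjointability. So does boundedness, which is listed so that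
  \<open>op_norm\<close> is visibly the infimum of a nonempty set.\<close>

definition adjointable_ops :: "('g, 'a::unital_cstar_algebra) l2_op set" where
  "adjointable_ops = {T. l2_map T \<and> op_bounds T \<noteq> {} \<and> (\<exists>S. is_l2_adjoint T S)}"


section \<open>The reduced crossed product\<close>

text \<open>The regular covariant representation on \<open>l2\<close>: \<open>(\<pi>(a) \<xi>)(g) = \<alpha>\<^bsub>- g\<^esub>(a) \<xi>(g)\<close> and
  \<open>(u\<^sub>h \<xi>)(g) = \<xi>(h\<^sup>-\<^sup>1 g)\<close>, so that \<open>u\<^sub>h \<pi>(a) u\<^sub>h\<^sup>* = \<pi>(\<alpha>\<^sub>h(a))\<close>. The algebra \<open>A\<close> is embedded in
  the crossed product by \<open>\<pi>\<close>.\<close>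

definition cp_embed ::
    "('g::group_add \<Rightarrow> 'a::unital_cstar_algebra \<Rightarrow> 'a) \<Rightarrow> 'a \<Rightarrow> ('g, 'a) l2_op" where
  "cp_embed \<alpha> a = (\<lambda>\<xi>. if \<xi> \<in> l2 then (\<lambda>g. \<alpha> (- g) a * \<xi> g) else 0)"

definition cp_unitary :: "'g::group_add \<Rightarrow> ('g, 'a::unital_cstar_algebra) l2_op" where
  "cp_unitary h = (\<lambda>\<xi>. if \<xi> \<in> l2 then (\<lambda>g. \<xi> (- h + g)) else 0)"

definition algebraic_crossed_product ::
    "('g::group_add \<Rightarrow> 'a::unital_cstar_algebra \<Rightarrow> 'a) \<Rightarrow> ('g, 'a) l2_op set" where
  "algebraic_crossed_product \<alpha> =
     {x. \<exists>F a. finite F \<and> x = (\<Sum>g\<in>F. cp_embed \<alpha> (a g) \<circ> cp_unitary g)}"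

definition reduced_crossed_product ::
    "('g::group_add \<Rightarrow> 'a::unital_cstar_algebra \<Rightarrow> 'a) \<Rightarrow> ('g, 'a) l2_op set" where
  "reduced_crossed_product \<alpha> =
     {x \<in> adjointable_ops. \<forall>\<epsilon>>0. \<exists>y \<in> algebraic_crossed_product \<alpha>. op_norm (x - y) < \<epsilon>}"

text \<open>The canonical conditional expectation \<open>E(x) = \<langle>\<delta>\<^sub>e | x \<delta>\<^sub>e\<rangle> = (x \<delta>\<^sub>e)(e)\<close>, with values in \<open>A\<close>
  itself; it sends \<open>\<pi>(a) u\<^sub>g\<close> to \<open>a\<close> if \<open>g = e\<close> and to \<open>0\<close> otherwise.\<close>

definition cp_expectation :: "('g::group_add, 'a::unital_cstar_algebra) l2_op \<Rightarrow> 'a" where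
  "cp_expectation x = x (\<lambda>g. if g = 0 then 1 else 0) 0"

definition cp_supp :: "('g::group_add, 'a::unital_cstar_algebra) l2_op \<Rightarrow> 'g set" where
  "cp_supp x = {g. cp_expectation (x \<circ> cp_unitary (- g)) \<noteq> 0}"

definition cp_supp_set :: "('g::group_add, 'a::unital_cstar_algebra) l2_op set \<Rightarrow> 'g set" where
  "cp_supp_set X = (\<Union>x\<in>X. cp_supp x)"

definition replete ::
    "('g::group_add \<Rightarrow> 'a::unital_cstar_algebra \<Rightarrow> 'a) \<Rightarrow> ('g, 'a) l2_op set \<Rightarrow> bool" where
  "replete \<alpha> X \<longleftrightarrow> (\<forall>y \<in> reduced_crossed_product \<alpha>. cp_supp y \<subseteq> cp_supp_set X \<longrightarrow> y \<in> X)"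

definition cp_bimodule ::
    "('g::group_add \<Rightarrow> 'a::unital_cstar_algebra \<Rightarrow> 'a) \<Rightarrow> ('g, 'a) l2_op set \<Rightarrow> bool" where
  "cp_bimodule \<alpha> X \<longleftrightarrow> X \<subseteq> reduced_crossed_product \<alpha> \<and> complex_subspace X \<and>
     (\<forall>x\<in>X. \<forall>a. cp_embed \<alpha> a \<circ> x \<in> X \<and> x \<circ> cp_embed \<alpha> a \<in> X)"

definition cp_norm_closed ::
    "('g::group_add \<Rightarrow> 'a::unital_cstar_algebra \<Rightarrow> 'a) \<Rightarrow> ('g, 'a) l2_op set \<Rightarrow> bool" where
  "cp_norm_closed \<alpha> X \<longleftrightarrow>
     (\<forall>y \<in> reduced_crossed_product \<alpha>. (\<forall>\<epsilon>>0. \<exists>x\<in>X. op_norm (y - x) < \<epsilon>) \<longrightarrow> y \<in> X)"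

definition replete_closed_bimodules ::
    "('g::group_add \<Rightarrow> 'a::unital_cstar_algebra \<Rightarrow> 'a) \<Rightarrow> ('g, 'a) l2_op set set" where
  "replete_closed_bimodules \<alpha> = {X. cp_bimodule \<alpha> X \<and> replete \<alpha> X \<and> cp_norm_closed \<alpha> X}"


section \<open>C*-correspondences\<close>

locale right_hilbert_module =
  fixes rmul :: "'h::complex_banach \<Rightarrow> 'a::unital_cstar_algebra \<Rightarrow> 'h"
    and ip :: "'h \<Rightarrow> 'h \<Rightarrow> 'a"
  assumes rmul_add_left: "rmul (x + y) a = rmul x a + rmul y a"
    and rmul_add_right: "rmul x (a + b) = rmul x a + rmul x b"
    and rmul_scaleC_left: "rmul (c *\<^sub>C x) a = c *\<^sub>C rmul x a"
    and rmul_scaleC_right: "rmul x (c *\<^sub>C a) = c *\<^sub>C rmul x a"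
    and rmul_mult: "rmul x (a * b) = rmul (rmul x a) b"
    and rmul_one: "rmul x 1 = x"
    and ip_add_right: "ip x (y + z) = ip x y + ip x z"
    and ip_scaleC_right: "ip x (c *\<^sub>C y) = c *\<^sub>C ip x y"
    and ip_rmul_right: "ip x (rmul y a) = ip x y * a"
    and star_ip: "star (ip x y) = ip y x"
    and ip_positive: "\<exists>a. ip x x = star a * a"
    and norm_ip: "norm x = sqrt (norm (ip x x))"

locale right_correspondence = right_hilbert_module rmul ip
  for rmul :: "'h::complex_banach \<Rightarrow> 'a::unital_cstar_algebra \<Rightarrow> 'h"
    and ip :: "'h \<Rightarrow> 'h \<Rightarrow> 'a" +
  fixes lmul :: "'a \<Rightarrow> 'h \<Rightarrow> 'h"
  assumes lmul_add: "lmul (a + b) x = lmul a x + lmul b x"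
    and lmul_scaleC: "lmul (c *\<^sub>C a) x = c *\<^sub>C lmul a x"
    and lmul_mult: "lmul (a * b) x = lmul a (lmul b x)"
    and lmul_one: "lmul 1 x = x"
    and lmul_adjoint: "ip (lmul a x) y = ip x (lmul (star a) y)"

text \<open>\<open>\<Lambda>\<close> exhibits the correspondence as the completion of the reduced crossed product \<open>B\<close> with
  respect to \<open>\<langle>x | y\<rangle> = E(x\<^sup>* y)\<close>. This determines the correspondence up to a unique isomorphism
  compatible with \<open>\<Lambda>\<close>; completeness is part of the class \<open>complex_banach\<close>.\<close>

locale crossed_product_completion = right_correspondence rmul ip lmul
  for rmul :: "'h::complex_banach \<Rightarrow> 'a::unital_cstar_algebra \<Rightarrow> 'h"
    and ip :: "'h \<Rightarrow> 'h \<Rightarrow> 'a"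
    and lmul :: "'a \<Rightarrow> 'h \<Rightarrow> 'h" +
  fixes \<alpha> :: "'g::group_add \<Rightarrow> 'a \<Rightarrow> 'a"
    and \<Lambda> :: "('g, 'a) l2_op \<Rightarrow> 'h"
  assumes \<Lambda>_add: "\<lbrakk>x \<in> reduced_crossed_product \<alpha>; y \<in> reduced_crossed_product \<alpha>\<rbrakk>
        \<Longrightarrow> \<Lambda> (x + y) = \<Lambda> x + \<Lambda> y"
    and \<Lambda>_scaleC: "x \<in> reduced_crossed_product \<alpha> \<Longrightarrow> \<Lambda> (c *\<^sub>C x) = c *\<^sub>C \<Lambda> x"
    and \<Lambda>_left: "x \<in> reduced_crossed_product \<alpha> \<Longrightarrow> \<Lambda> (cp_embed \<alpha> a \<circ> x) = lmul a (\<Lambda> x)"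
    and \<Lambda>_right: "x \<in> reduced_crossed_product \<alpha> \<Longrightarrow> \<Lambda> (x \<circ> cp_embed \<alpha> a) = rmul (\<Lambda> x) a"
    and \<Lambda>_ip: "\<lbrakk>x \<in> reduced_crossed_product \<alpha>; y \<in> reduced_crossed_product \<alpha>\<rbrakk>
        \<Longrightarrow> ip (\<Lambda> x) (\<Lambda> y) = cp_expectation (l2_adj x \<circ> y)"
    and \<Lambda>_dense: "closure (\<Lambda> ` reduced_crossed_product \<alpha>) = UNIV"

text \<open>A closed sub-bimodule is a right C*-correspondence for the restricted operations; its left
  action is by adjointable operators because it is invariant under \<open>a\<close> and \<open>a\<^sup>*\<close>.\<close>

definition subcorrespondence ::
    "('h::complex_banach \<Rightarrow> 'a::unital_cstar_algebra \<Rightarrow> 'h) \<Rightarrow> ('a \<Rightarrow> 'h \<Rightarrow> 'h) \<Rightarrow> 'h set \<Rightarrow> bool" where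
  "subcorrespondence rmul lmul L \<longleftrightarrow> complex_subspace L \<and> closed L \<and>
     (\<forall>x\<in>L. \<forall>a. lmul a x \<in> L \<and> rmul x a \<in> L)"

definition orth_complement ::
    "('h \<Rightarrow> 'h \<Rightarrow> 'a::unital_cstar_algebra) \<Rightarrow> 'h set \<Rightarrow> 'h set" where
  "orth_complement ip L = {y. \<forall>x\<in>L. ip x y = 0}"

definition complemented_subcorrespondences ::
    "('h::complex_banach \<Rightarrow> 'a::unital_cstar_algebra \<Rightarrow> 'h) \<Rightarrow> ('h \<Rightarrow> 'h \<Rightarrow> 'a) \<Rightarrow>
     ('a \<Rightarrow> 'h \<Rightarrow> 'h) \<Rightarrow> 'h set set" where
  "complemented_subcorrespondences rmul ip lmul =
     {L. subcorrespondence rmul lmul L \<and> (\<forall>z. \<exists>x\<in>L. \<exists>y\<in>orth_complement ip L. z = x + y)}"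

end

theory Submission
  imports Defs
begin

text \<open>Let \<open>v\<^sub>g\<close> be the image of \<open>u\<^sub>g\<close> in the completion. The \<open>v\<^sub>g\<close> are orthonormal, satisfy
  \<open>a v\<^sub>g = v\<^sub>g \<alpha>\<^bsub>- g\<^esub>(a)\<close>, and their \<open>A\<close>-linear combinations are dense. Both sides of the bijection turn
  out to be copies of the power set of the group: to a set \<open>S\<close> correspond the operators with support in
  \<open>S\<close> and the vectors \<open>z\<close> with \<open>\<langle>v\<^sub>g | z\<rangle> = 0\<close> for all \<open>g\<close> outside \<open>S\<close>
  (\<open>operators_on S\<close> and \<open>supported_on S\<close>).

  For bimodules of operators this is repleteness, because the Fourier coefficient of \<open>x\<close> at \<open>g\<close>
  vanishes exactly if \<open>\<langle>v\<^sub>g | \<Lambda> x\<rangle>\<close> does (\<open>cp_supp_eq\<close>). For a complemented subcorrespondence \<open>L\<close>, the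
  orthogonal projection \<open>P\<close> onto \<open>L\<close> commutes with both actions of \<open>A\<close>, so its matrix entries
  \<open>t = \<langle>v\<^sub>h | P v\<^sub>g\<rangle>\<close> satisfy \<open>t \<alpha>\<^bsub>- g\<^esub>(a) = \<alpha>\<^bsub>- h\<^esub>(a) t\<close>. Then \<open>t\<^sup>* t\<close> and \<open>t t\<^sup>*\<close> are central, hence scalars
  since \<open>A\<close> is simple; a nonzero \<open>t\<close> would be a multiple of a unitary that identifies the bimodules
  \<open>\<^sub>gA\<close> and \<open>\<^sub>hA\<close>, which outerness excludes for \<open>g \<noteq> h\<close> (\<open>outer_intertwiner_zero\<close>). The diagonal entries
  are central and self-adjoint, hence real scalars, so that each \<open>v\<^sub>g\<close> lies in \<open>L\<close> or is orthogonal to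
  it (\<open>complemented_contains_v_or_orthogonal\<close>), and \<open>L\<close> is the set of vectors supported on
  \<open>{g. v\<^sub>g \<in> L}\<close>. Finally \<open>\<Lambda>\<close> maps \<open>operators_on S\<close> onto a dense subspace of \<open>supported_on S\<close>: a finite
  combination of the \<open>v\<^sub>g\<close> close to a vector supported on \<open>S\<close> stays close when its terms outside \<open>S\<close>
  are deleted.

  These arguments rest on the order structure of a C*-algebra: \<open>x\<^sup>* x\<close> is positive, and \<open>0 \<le> p \<le> q\<close>
  implies \<open>\<parallel>p\<parallel> \<le> \<parallel>q\<parallel>\<close>. This gives that left multiplication by a bounded family acts boundedly on
  square-summable functions, so that the crossed product consists of adjointable operators, and the
  Cauchy-Schwarz inequality in Hilbert modules. It is derived from two facts on a self-adjoint
  element: its spectrum is real, and contains a point of modulus equal to the norm. The second fact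
  also yields that a simple algebra has no self-adjoint central elements except scalars.\<close>

section \<open>Scalars and the involution\<close>

lemma scaleC_zero_left [simp]: "0 *\<^sub>C (x::'a::complex_banach) = 0"
  using scaleC_add_left[of 0 0 x] by simp

lemma scaleC_zero_right [simp]: "c *\<^sub>C (0::'a::complex_banach) = 0"
  using scaleC_add_right[of c 0 "0::'a"] by simp

lemma scaleC_one [simp]: "1 *\<^sub>C (x::'a::complex_banach) = x"
  using scaleR_scaleC[of 1 x] by simp

lemma scaleC_minus_left [simp]: "(- c) *\<^sub>C (x::'a::complex_banach) = - (c *\<^sub>C x)"
  using scaleC_add_left[of "- c" c x] by (simp add: eq_neg_iff_add_eq_0)

lemma scaleC_minus_right [simp]: "c *\<^sub>C (- x::'a::complex_banach) = - (c *\<^sub>C x)"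
  using scaleC_add_right[of c "- x" x] by (simp add: eq_neg_iff_add_eq_0)

lemma scaleC_diff_left: "(c - d) *\<^sub>C (x::'a::complex_banach) = c *\<^sub>C x - d *\<^sub>C x"
  using scaleC_add_left[of c "- d" x] by simp

lemma scaleC_diff_right: "c *\<^sub>C (x - y::'a::complex_banach) = c *\<^sub>C x - c *\<^sub>C y"
  using scaleC_add_right[of c x "- y"] by simp

lemma scaleC_2: "2 *\<^sub>C (x::'a::complex_banach) = x + x"
  using scaleC_add_left[of 1 1 x] by simp

lemmas scaleC_algebra = scaleC_add_left scaleC_add_right scaleC_diff_left scaleC_diff_right
  scaleC_scaleC scaleC_mult_left scaleC_mult_right

lemma star_zero [simp]: "star (0::'a::unital_cstar_algebra) = 0"
  using star_add[of 0 "0::'a"] by simp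

lemma star_minus: "star (- x) = - star (x::'a::unital_cstar_algebra)"
  using star_add[of "- x" x] by (simp add: eq_neg_iff_add_eq_0)

lemma star_diff: "star (x - y) = star x - star (y::'a::unital_cstar_algebra)"
  using star_add[of x "- y"] by (simp add: star_minus)

lemma star_one [simp]: "star (1::'a::unital_cstar_algebra) = 1"
  by (metis mult.left_neutral mult.right_neutral star_mult star_star)

lemma star_power: "star (x ^ n) = star (x::'a::unital_cstar_algebra) ^ n"
  by (induction n) (simp_all add: star_mult power_commutes)

lemma star_scaleR: "star (r *\<^sub>R x) = r *\<^sub>R star (x::'a::unital_cstar_algebra)"
  by (simp add: scaleR_scaleC star_scaleC)

lemmas star_simps = star_add star_diff star_minus star_scaleC star_scaleR star_mult star_star

lemma norm_star [simp]: "norm (star x) = norm (x::'a::unital_cstar_algebra)"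
proof -
  have le: "norm y \<le> norm (star y)" for y :: 'a
  proof (cases "y = 0")
    case False
    have "norm y * norm y \<le> norm (star y) * norm y"
      by (metis cstar_identity norm_mult_ineq power2_eq_square)
    then show ?thesis using False by simp
  qed simp
  show ?thesis using le[of x] le[of "star x"] by (simp add: star_star)
qed

lemma star_mult_self_eq_0 [simp]: "star x * x = 0 \<longleftrightarrow> x = (0::'a::unital_cstar_algebra)"
  using cstar_identity[of x] by auto

lemma norm_self_adjoint_square:
  fixes x :: "'a::unital_cstar_algebra"
  assumes "star x = x"
  shows "norm (x * x) = norm x * norm x"
  using cstar_identity[of x] assms by (simp add: power2_eq_square)

lemma norm_self_adjoint_power:
  fixes x :: "'a::unital_cstar_algebra"
  assumes "star x = x"
  shows "norm (x ^ (2 ^ n)) = norm x ^ (2 ^ n)"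
proof (induction n)
  case (Suc n)
  have "x ^ (2 ^ Suc n) = x ^ (2 ^ n) * x ^ (2 ^ n)"
    by (simp add: mult_2 power_add)
  then show ?case
    using Suc assms norm_self_adjoint_square[of "x ^ (2 ^ n)"]
    by (simp add: star_power mult_2 power_add)
qed simp


section \<open>Invertible elements and the spectrum\<close>

definition invertible_elt :: "'a::unital_cstar_algebra \<Rightarrow> bool" where
  "invertible_elt x \<longleftrightarrow> (\<exists>y. x * y = 1 \<and> y * x = 1)"

definition inverse_elt :: "'a::unital_cstar_algebra \<Rightarrow> 'a" where
  "inverse_elt x = (SOME y. x * y = 1 \<and> y * x = 1)"

definition spec :: "'a::unital_cstar_algebra \<Rightarrow> complex set" where
  "spec x = {c. \<not> invertible_elt (x - c *\<^sub>C 1)}"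

lemma inverse_elt:
  assumes "invertible_elt x"
  shows "x * inverse_elt x = 1" "inverse_elt x * x = 1"
  using someI_ex[OF assms[unfolded invertible_elt_def]] by (auto simp: inverse_elt_def)

lemma invertible_eltI: "x * y = 1 \<Longrightarrow> y * x = 1 \<Longrightarrow> invertible_elt x"
  by (auto simp: invertible_elt_def)

lemma invertible_elt_scaleC:
  assumes "c \<noteq> 0"
  shows "invertible_elt (c *\<^sub>C x) \<longleftrightarrow> invertible_elt x"
proof -
  have imp: "invertible_elt (d *\<^sub>C y)" if "invertible_elt y" "d \<noteq> 0" for d and y :: 'a
    using that inverse_elt[OF that(1)]
    by (intro invertible_eltI[of _ "inverse d *\<^sub>C inverse_elt y"]) (simp_all add: scaleC_algebra)
  show ?thesis
    using imp[of x c] imp[of "c *\<^sub>C x" "inverse c"] assms by (auto simp: scaleC_scaleC)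
qed

lemma invertible_elt_minus: "invertible_elt (- x) \<longleftrightarrow> invertible_elt x"
  using invertible_elt_scaleC[of "-1" x] by simp

lemma spec_scaleC:
  assumes "c \<noteq> 0"
  shows "spec (c *\<^sub>C x) = (*) c ` spec x"
proof -
  have "invertible_elt (c *\<^sub>C x - d *\<^sub>C 1) \<longleftrightarrow> invertible_elt (x - (d / c) *\<^sub>C 1)" for d
    using invertible_elt_scaleC[OF assms, of "x - (d / c) *\<^sub>C 1"] assms by (simp add: scaleC_algebra)
  then show ?thesis using assms
    by (auto simp: spec_def image_iff) (metis nonzero_mult_div_cancel_left times_divide_eq_right)
qed

lemma spec_minus: "c \<in> spec (- x) \<longleftrightarrow> - c \<in> spec x"
proof -
  have "- x - c *\<^sub>C 1 = - (x - (- c) *\<^sub>C 1)" by simp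
  then show ?thesis unfolding spec_def mem_Collect_eq by (metis invertible_elt_minus)
qed

lemma spec_add_scalar: "c \<in> spec (x + d *\<^sub>C 1) \<longleftrightarrow> c - d \<in> spec x"
proof -
  have "x + d *\<^sub>C 1 - c *\<^sub>C 1 = x - (c - d) *\<^sub>C 1" by (simp add: scaleC_diff_left)
  then show ?thesis unfolding spec_def mem_Collect_eq by (simp only:)
qed

lemma spec_scalar_diff: "c \<in> spec (d *\<^sub>C 1 - x) \<longleftrightarrow> d - c \<in> spec x"
  using spec_add_scalar[of c "- x" d] spec_minus[of "c - d" x] by (simp add: add.commute)

lemma invertible_elt_one_minus:
  fixes x :: "'a::unital_cstar_algebra"
  assumes "norm x < 1"
  shows "invertible_elt (1 - x)"
proof -
  have sm: "summable (\<lambda>n. x ^ n)" using assms by (rule complete_algebra_summable_geometric)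
  define y where "y = (\<Sum>n. x ^ n)"
  have a: "(\<lambda>n. x ^ n) sums y" unfolding y_def using sm by (rule summable_sums)
  have b: "(\<lambda>n. x ^ Suc n) sums (y - 1)"
    using a sums_split_initial_segment[OF a, of 1] by simp
  have "x * y = y - 1"
    using sums_unique2[OF sums_mult[OF a, of x]] b by simp
  moreover have "y * x = y - 1"
    using sums_unique2[OF sums_mult2[OF a, of x]] b by (simp add: power_commutes)
  ultimately show ?thesis
    by (intro invertible_eltI[of _ y]) (simp_all add: algebra_simps)
qed

lemma spec_norm_le:
  assumes "c \<in> spec x"
  shows "cmod c \<le> norm x"
proof (rule ccontr)
  assume "\<not> cmod c \<le> norm x"
  then have c: "c \<noteq> 0" "norm (inverse c *\<^sub>C x) < 1"
    by (auto simp: norm_scaleC norm_inverse norm_divide divide_simps not_le)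
  have "invertible_elt ((- c) *\<^sub>C (1 - inverse c *\<^sub>C x))"
    using invertible_elt_one_minus[OF c(2)] c(1) by (subst invertible_elt_scaleC) auto
  moreover have "(- c) *\<^sub>C (1 - inverse c *\<^sub>C x) = x - c *\<^sub>C 1"
    using c(1) by (simp add: scaleC_algebra)
  ultimately show False using assms by (simp add: spec_def)
qed

lemma invertible_elt_one_minus_mult_commute:
  fixes x y :: "'a::unital_cstar_algebra"
  assumes "invertible_elt (1 - x * y)"
  shows "invertible_elt (1 - y * x)"
proof -
  obtain c where c: "(1 - x * y) * c = 1" "c * (1 - x * y) = 1"
    using assms by (auto simp: invertible_elt_def)
  have c1: "x * y * c = c - 1" and c2: "c * (x * y) = c - 1"
    using c by (simp_all add: algebra_simps)
  show ?thesis
  proof (rule invertible_eltI)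
    have "y * (x * y * c) * x = y * c * x - y * x" unfolding c1 by (simp add: algebra_simps)
    then show "(1 - y * x) * (1 + y * c * x) = 1" by (simp add: algebra_simps)
    have "y * (c * (x * y)) * x = y * c * x - y * x" unfolding c2 by (simp add: algebra_simps)
    then show "(1 + y * c * x) * (1 - y * x) = 1" by (simp add: algebra_simps)
  qed
qed

lemma spec_mult_commute:
  assumes "c \<in> spec (x * y)" "c \<noteq> 0"
  shows "c \<in> spec (y * x)"
proof (rule ccontr)
  have eq: "a * b - c *\<^sub>C 1 = (- c) *\<^sub>C (1 - (inverse c *\<^sub>C a) * b)"
       "a * b - c *\<^sub>C 1 = (- c) *\<^sub>C (1 - a * (inverse c *\<^sub>C b))" for a b :: 'a
    using assms(2) by (simp_all add: scaleC_algebra)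
  have nz: "- c \<noteq> 0" using assms(2) by simp
  assume "c \<notin> spec (y * x)"
  then have "invertible_elt (1 - y * (inverse c *\<^sub>C x))"
    unfolding spec_def mem_Collect_eq eq(2) invertible_elt_scaleC[OF nz] by simp
  then have "invertible_elt (1 - (inverse c *\<^sub>C x) * y)"
    by (rule invertible_elt_one_minus_mult_commute)
  then show False
    using assms(1) unfolding spec_def mem_Collect_eq eq(1) invertible_elt_scaleC[OF nz] by simp
qed

text \<open>Adding \<open>\<i> r\<close> to a self-adjoint element \<open>w\<close> changes the square of its norm to at most
  \<open>\<parallel>w\<parallel>\<^sup>2 + r\<^sup>2\<close>, whereas it would move a spectral point \<open>\<i>\<close> to \<open>\<i> (1 + r)\<close>.\<close>

lemma spec_self_adjoint_real:
  fixes x :: "'a::unital_cstar_algebra"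
  assumes sa: "star x = x" and c: "c \<in> spec x"
  shows "Im c = 0"
proof (rule ccontr)
  assume im: "Im c \<noteq> 0"
  \<comment> \<open>An affine change of \<open>x\<close> moves the spectral point \<open>c\<close> to \<open>\<i>\<close>.\<close>
  define w where "w = complex_of_real (1 / Im c) *\<^sub>C (x + complex_of_real (- Re c) *\<^sub>C 1)"
  have wsa: "star w = w" by (simp add: w_def star_simps sa)
  have "c + complex_of_real (- Re c) \<in> spec (x + complex_of_real (- Re c) *\<^sub>C 1)"
    unfolding spec_add_scalar using c by simp
  then have "complex_of_real (1 / Im c) * (c + complex_of_real (- Re c)) \<in> spec w"
    unfolding w_def using im by (subst spec_scaleC) auto
  moreover have "complex_of_real (1 / Im c) * (c + complex_of_real (- Re c)) = \<i>"
    using im by (simp add: complex_eq_iff)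
  ultimately have "\<i> \<in> spec w" by simp
  \<comment> \<open>With this \<open>r\<close> the inequality \<open>(1 + r)\<^sup>2 \<le> \<parallel>w\<parallel>\<^sup>2 + r\<^sup>2\<close> fails.\<close>
  define r where "r = (norm w)\<^sup>2"
  have "\<i> + \<i> * r \<in> spec (w + (\<i> * r) *\<^sub>C 1)"
    unfolding spec_add_scalar using \<open>\<i> \<in> spec w\<close> by simp
  then have "cmod (\<i> + \<i> * r) \<le> norm (w + (\<i> * r) *\<^sub>C 1)" by (rule spec_norm_le)
  moreover have "cmod (\<i> + \<i> * r) = 1 + r"
  proof -
    have "\<i> + \<i> * r = \<i> * complex_of_real (1 + r)" by (simp add: algebra_simps)
    moreover have "0 \<le> r" by (simp add: r_def)
    ultimately show ?thesis by (simp only: norm_mult norm_of_real) simp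
  qed
  ultimately have "(1 + r)\<^sup>2 \<le> (norm (w + (\<i> * r) *\<^sub>C 1))\<^sup>2"
    by (intro power_mono) (auto simp: r_def)
  also have "\<dots> = norm (star (w + (\<i> * r) *\<^sub>C 1) * (w + (\<i> * r) *\<^sub>C 1))"
    by (simp add: cstar_identity)
  also have "star (w + (\<i> * r) *\<^sub>C 1) * (w + (\<i> * r) *\<^sub>C 1) = w * w + complex_of_real (r\<^sup>2) *\<^sub>C 1"
    by (simp add: star_simps wsa scaleC_algebra algebra_simps power2_eq_square)
  also have "norm \<dots> \<le> r + r\<^sup>2"
    using norm_triangle_ineq[of "w * w" "complex_of_real (r\<^sup>2) *\<^sub>C 1"] norm_self_adjoint_square[OF wsa]
    by (simp add: norm_scaleC r_def power2_eq_square norm_mult)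
  finally have "1 + r \<le> 0" by (simp add: power2_eq_square algebra_simps)
  then show False by (simp add: r_def) (smt (verit) zero_le_power2)
qed

text \<open>The resolvent identity \<open>R(l) - R(m) = (l - m) R(l) z R(m)\<close> bounds first \<open>\<parallel>R(m)\<parallel>\<close> and then the
  difference for \<open>m\<close> near \<open>l\<close>.\<close>

lemma resolvent_continuous:
  fixes z :: "'a::unital_cstar_algebra"
  assumes inv: "\<And>m. m \<in> D \<Longrightarrow> invertible_elt (1 - m *\<^sub>C z)"
  shows "continuous_on D (\<lambda>m. inverse_elt (1 - m *\<^sub>C z))"
proof -
  define R where "R = (\<lambda>m. inverse_elt (1 - m *\<^sub>C z))"
  have diff: "R l - R m = (l - m) *\<^sub>C (R l * z * R m)" if "l \<in> D" "m \<in> D" for l m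
  proof -
    have "R l * (1 - l *\<^sub>C z) = 1" "(1 - m *\<^sub>C z) * R m = 1"
      using inverse_elt[OF inv] that by (auto simp: R_def)
    then have "R l - R m = R l * ((1 - m *\<^sub>C z) * R m) - (R l * (1 - l *\<^sub>C z)) * R m" by simp
    also have "\<dots> = (l - m) *\<^sub>C (R l * z * R m)" by (simp add: algebra_simps scaleC_algebra)
    finally show ?thesis .
  qed
  have "\<exists>d>0. \<forall>m\<in>D. dist m l < d \<longrightarrow> dist (R m) (R l) < e" if l: "l \<in> D" and e: "e > 0" for l e
  proof -
    define K where "K = norm (R l) * norm z + 1"
    define M where "M = 2 * (norm (R l) + 1)"
    have K: "K > 0" unfolding K_def by (smt (verit) mult_nonneg_nonneg norm_ge_zero)
    have M: "M > 0" unfolding M_def by (smt (verit) norm_ge_zero)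
    \<comment> \<open>The first term of the minimum gives \<open>\<parallel>R(m)\<parallel> \<le> 2 \<parallel>R(l)\<parallel>\<close>, the second the estimate by \<open>e\<close>.\<close>
    define d where "d = min (1 / (2 * K)) (e / (K * M))"
    have "dist (R m) (R l) < e" if m: "m \<in> D" "dist m l < d" for m
    proof -
      have lm: "cmod (l - m) < d" using m(2) by (simp add: dist_norm norm_minus_commute)
      have b: "norm (R l - R m) \<le> cmod (l - m) * K * norm (R m)"
      proof -
        have "norm (R l - R m) = cmod (l - m) * norm (R l * z * R m)"
          using diff[OF l m(1)] by (simp add: norm_scaleC)
        also have "norm (R l * z * R m) \<le> norm (R l) * norm z * norm (R m)"
          by (meson mult_right_mono norm_ge_zero norm_mult_ineq order_trans)
        also have "\<dots> \<le> K * norm (R m)" by (intro mult_right_mono) (auto simp: K_def)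
        finally show ?thesis by (simp add: mult.assoc mult_left_mono)
      qed
      have "cmod (l - m) * K \<le> 1 / 2" using lm K by (simp add: d_def field_simps)
      then have "cmod (l - m) * K * norm (R m) \<le> 1 / 2 * norm (R m)" by (rule mult_right_mono) simp
      moreover have "norm (R m) \<le> norm (R l) + norm (R l - R m)"
        by (smt (verit) norm_minus_commute norm_triangle_sub)
      ultimately have Rm: "norm (R m) \<le> M" using b by (simp add: M_def)
      have "cmod (l - m) * K * norm (R m) \<le> cmod (l - m) * K * M"
        using Rm K by (intro mult_left_mono) auto
      also have "\<dots> < e" using lm K M by (simp add: d_def field_simps)
      finally show ?thesis using b by (simp add: dist_norm norm_minus_commute)
    qed
    moreover have "d > 0" using K M e by (simp add: d_def)
    ultimately show ?thesis by blast
  qed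
  then show ?thesis unfolding continuous_on_iff R_def by blast
qed

text \<open>This is an argument of Rickart, which uses no complex integration. If \<open>1 - m z\<close> were invertible
  for all \<open>m\<close> in the closed unit disc, its inverse would be uniformly continuous there. The identity
  \<open>2 (1 - w\<^sup>2)\<^sup>-\<^sup>1 = (1 - w)\<^sup>-\<^sup>1 + (1 + w)\<^sup>-\<^sup>1\<close> carries a bound on the difference of the inverses at radii
  \<open>r\<close> and \<open>1\<close> from \<open>z\<close> to all powers \<open>z\<^sup>n\<close> with \<open>n = 2\<^sup>k\<close>. But \<open>(1 - r\<^sup>n z\<^sup>n)\<^sup>-\<^sup>1\<close> tends to \<open>1\<close>, while
  \<open>(1 - z\<^sup>n)\<^sup>-\<^sup>1\<close> cannot be close to \<open>1\<close> since \<open>\<parallel>z\<^sup>n\<parallel> = 1\<close>.\<close>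

lemma unit_circle_resolvent:
  fixes z :: "'a::unital_cstar_algebra"
  assumes nz: "\<And>n. norm (z ^ (2 ^ n)) = 1"
  shows "\<exists>m. cmod m = 1 \<and> \<not> invertible_elt (1 - m *\<^sub>C z)"
proof (rule ccontr)
  assume "\<not> ?thesis"
  then have unit: "invertible_elt (1 - m *\<^sub>C z)" if "cmod m = 1" for m using that by blast
  have z1: "norm z = 1" using nz[of 0] by simp
  have inv: "invertible_elt (1 - m *\<^sub>C z)" if "m \<in> cball 0 1" for m
    using that unit[of m] invertible_elt_one_minus[of "m *\<^sub>C z"] z1
    by (cases "cmod m = 1") (auto simp: norm_scaleC)
  have "uniformly_continuous_on (cball 0 1) (\<lambda>m. inverse_elt (1 - m *\<^sub>C z))"
    using resolvent_continuous[of "cball 0 1" z, OF inv] by (intro compact_uniformly_continuous) auto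
  then obtain d where d: "d > 0" and uc: "\<And>l m. l \<in> cball 0 1 \<Longrightarrow> m \<in> cball 0 1 \<Longrightarrow> dist m l < d \<Longrightarrow>
      norm (inverse_elt (1 - m *\<^sub>C z) - inverse_elt (1 - l *\<^sub>C z)) < 1 / 4"
    unfolding uniformly_continuous_on_def dist_norm by (metis divide_pos_pos zero_less_numeral zero_less_one)
  \<comment> \<open>The radius \<open>r\<close> is so close to \<open>1\<close> that the radial oscillation of the resolvent is below \<open>1/4\<close>.\<close>
  define r where "r = max (1 / 2) (1 - d / 2)"
  have r: "0 < r" "r < 1" "1 - r < d" using d by (auto simp: r_def)
  have main: "\<exists>p q. (1 - (of_real (r ^ (2 ^ n)) * m) *\<^sub>C z ^ (2 ^ n)) * p = 1 \<and>
       p * (1 - (of_real (r ^ (2 ^ n)) * m) *\<^sub>C z ^ (2 ^ n)) = 1 \<and>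
       (1 - m *\<^sub>C z ^ (2 ^ n)) * q = 1 \<and> q * (1 - m *\<^sub>C z ^ (2 ^ n)) = 1 \<and> norm (p - q) \<le> 1 / 4"
    if "cmod m = 1" for m n
    using that
  proof (induction n arbitrary: m)
    case 0
    have b: "of_real r * m \<in> cball 0 1" "m \<in> cball 0 1" "dist m (of_real r * m) < d"
    proof -
      have "m - of_real r * m = of_real (1 - r) * m" by (simp add: algebra_simps)
      then show "dist m (of_real r * m) < d" using r 0 by (simp only: dist_norm norm_mult norm_of_real) simp
    qed (use 0 r in \<open>auto simp: norm_mult\<close>)
    show ?case
      using inverse_elt[OF inv[OF b(1)]] inverse_elt[OF inv[OF b(2)]] uc[OF b]
      by (intro exI[of _ "inverse_elt (1 - (of_real r * m) *\<^sub>C z)"] exI[of _ "inverse_elt (1 - m *\<^sub>C z)"])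
         (simp add: norm_minus_commute)
  next
    case (Suc n)
    \<comment> \<open>The hypothesis is used at both square roots \<open>s\<close> and \<open>- s\<close> of \<open>m\<close>, and the two estimates are averaged.\<close>
    define h where "h = (1/2 :: complex)"
    define s where "s = csqrt m"
    have s: "s * s = m" "cmod s = 1"
      using Suc.prems by (simp_all add: s_def power2_eq_square[symmetric])
    have avg: "(1 - (e * e) *\<^sub>C (w * w)) * (h *\<^sub>C (p + p')) = 1 \<and>
         (h *\<^sub>C (p + p')) * (1 - (e * e) *\<^sub>C (w * w)) = 1"
      if "(1 - e *\<^sub>C w) * p = 1" "p * (1 - e *\<^sub>C w) = 1" "(1 + e *\<^sub>C w) * p' = 1" "p' * (1 + e *\<^sub>C w) = 1"
      for e and w p p' :: 'a
    proof -
      have e1: "1 - (e * e) *\<^sub>C (w * w) = (1 + e *\<^sub>C w) * (1 - e *\<^sub>C w)"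
        and e2: "1 - (e * e) *\<^sub>C (w * w) = (1 - e *\<^sub>C w) * (1 + e *\<^sub>C w)"
        by (simp_all add: algebra_simps scaleC_algebra)
      have "(1 - (e * e) *\<^sub>C (w * w)) * p = 1 + e *\<^sub>C w" "p * (1 - (e * e) *\<^sub>C (w * w)) = 1 + e *\<^sub>C w"
        using that(1,2) e1 e2 by (metis mult.assoc mult.right_neutral, metis mult.assoc mult.left_neutral)
      moreover have "(1 - (e * e) *\<^sub>C (w * w)) * p' = 1 - e *\<^sub>C w" "p' * (1 - (e * e) *\<^sub>C (w * w)) = 1 - e *\<^sub>C w"
        using that(3,4) e1 e2 by (metis mult.assoc mult.right_neutral, metis mult.assoc mult.left_neutral)
      moreover have "h *\<^sub>C (1 + e *\<^sub>C w + (1 - e *\<^sub>C w)) = 1"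
      proof -
        have two: "1 + e *\<^sub>C w + (1 - e *\<^sub>C w) = 2 *\<^sub>C 1" by (simp add: scaleC_2)
        show ?thesis unfolding two scaleC_scaleC by (simp add: h_def)
      qed
      ultimately show ?thesis
        by (simp only: scaleC_mult_left scaleC_mult_right distrib_left distrib_right)
    qed
    let ?w = "z ^ (2 ^ n)" and ?r = "complex_of_real (r ^ (2 ^ n))"
    obtain p q where pq: "(1 - (?r * s) *\<^sub>C ?w) * p = 1" "p * (1 - (?r * s) *\<^sub>C ?w) = 1"
         "(1 - s *\<^sub>C ?w) * q = 1" "q * (1 - s *\<^sub>C ?w) = 1" "norm (p - q) \<le> 1 / 4"
      using Suc.IH[OF s(2)] by blast
    obtain p' q' where pq': "(1 + (?r * s) *\<^sub>C ?w) * p' = 1" "p' * (1 + (?r * s) *\<^sub>C ?w) = 1"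
         "(1 + s *\<^sub>C ?w) * q' = 1" "q' * (1 + s *\<^sub>C ?w) = 1" "norm (p' - q') \<le> 1 / 4"
      using Suc.IH[of "- s"] s(2) by auto
    have pw: "?w * ?w = z ^ (2 ^ Suc n)" and pr: "(?r * s) * (?r * s) = of_real (r ^ (2 ^ Suc n)) * m"
      using s(1) by (simp_all add: mult_2 power_add mult.commute mult.left_commute)
    have "norm (h *\<^sub>C (p + p') - h *\<^sub>C (q + q')) \<le> 1 / 4"
    proof -
      have "h *\<^sub>C (p + p') - h *\<^sub>C (q + q') = h *\<^sub>C ((p - q) + (p' - q'))" by (simp add: scaleC_algebra)
      then show ?thesis
        using norm_triangle_ineq[of "p - q" "p' - q'"] pq(5) pq'(5) by (simp add: norm_scaleC h_def)
    qed
    then show ?case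
      using avg[OF pq(1,2) pq'(1,2)] avg[OF pq(3,4) pq'(3,4)] unfolding pw pr s(1) by blast
  qed
  have "(\<lambda>n. r ^ n) \<longlonglongrightarrow> 0" using r by (intro LIMSEQ_power_zero) auto
  then obtain N where N: "\<And>n. n \<ge> N \<Longrightarrow> r ^ n < 1 / 6"
    using order_tendstoD(2)[of "\<lambda>n. r ^ n" 0 sequentially "1/6"] by (auto simp: eventually_sequentially)
  define k where "k = (2::nat) ^ N"
  have "N \<le> k" by (simp add: k_def less_imp_le)
  then have rk: "r ^ k < 1 / 6" by (rule N)
  obtain p q where p: "(1 - of_real (r ^ k) *\<^sub>C z ^ k) * p = 1"
      and q: "(1 - z ^ k) * q = 1" and pq: "norm (p - q) \<le> 1 / 4"
    using main[of 1 N] by (auto simp: k_def)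
  have zk: "norm (z ^ k) = 1" using nz by (simp add: k_def)
  have "norm (p - 1) < 1 / 4"
  proof -
    have "p - 1 = of_real (r ^ k) *\<^sub>C (z ^ k * p)" using p by (simp add: algebra_simps scaleC_algebra)
    then have "norm (p - 1) = r ^ k * norm (z ^ k * p)" using r by (simp add: norm_scaleC norm_power)
    also have "\<dots> \<le> r ^ k * norm p"
      using norm_mult_ineq[of "z ^ k" p] zk r by (intro mult_left_mono) auto
    finally have 1: "norm (p - 1) \<le> r ^ k * norm p" .
    also have "\<dots> \<le> 1 / 6 * norm p" using rk by (intro mult_right_mono) auto
    finally have le: "norm (p - 1) \<le> 1 / 6 * norm p" .
    then have "norm p < 5 / 4" using norm_triangle_ineq[of "p - 1" 1] by simp
    then show ?thesis using le by simp
  qed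
  then have q1: "norm (q - 1) < 1 / 2"
    using pq norm_triangle_ineq4[of "p - 1" "p - q"] by simp
  have "z ^ k = (q - 1) - z ^ k * (q - 1)" using q by (simp add: algebra_simps)
  then have "norm (z ^ k) \<le> norm (q - 1) + norm (z ^ k) * norm (q - 1)"
    by (smt (verit) norm_mult_ineq norm_triangle_ineq4)
  then show False using q1 zk by simp
qed

text \<open>For a self-adjoint element of norm \<open>1\<close> the C*-identity gives \<open>\<parallel>x\<^sup>n\<parallel> = 1\<close> for \<open>n = 2\<^sup>k\<close>. This fact
  serves below both as the spectral radius formula and as the nonemptiness of the spectrum.\<close>

lemma spec_self_adjoint_attains_norm:
  fixes x :: "'a::unital_cstar_algebra"
  assumes sa: "star x = x"
  shows "\<exists>c\<in>spec x. cmod c = norm x"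
proof (cases "x = 0")
  case True
  then show ?thesis by (intro bexI[of _ 0]) (auto simp: spec_def invertible_elt_def)
next
  case False
  define z where "z = complex_of_real (1 / norm x) *\<^sub>C x"
  have "star z = z" by (simp add: z_def star_simps sa)
  moreover have "norm z = 1" using False by (simp add: z_def norm_scaleC norm_divide)
  ultimately have "norm (z ^ (2 ^ n)) = 1" for n using norm_self_adjoint_power[of z n] by simp
  then obtain m where m: "cmod m = 1" "\<not> invertible_elt (1 - m *\<^sub>C z)"
    using unit_circle_resolvent by blast
  define c where "c = of_real (norm x) / m"
  have m0: "m \<noteq> 0" using m(1) by auto
  have "x - c *\<^sub>C 1 = (- c) *\<^sub>C (1 - m *\<^sub>C z)"
    using False m0 by (simp add: z_def c_def scaleC_algebra)
  moreover have "- c \<noteq> 0" using False m0 by (simp add: c_def)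
  ultimately have "c \<in> spec x" using m(2) invertible_elt_scaleC[of "- c" "1 - m *\<^sub>C z"] by (simp add: spec_def)
  moreover have "cmod c = norm x" using m(1) by (simp add: c_def norm_divide)
  ultimately show ?thesis by blast
qed

section \<open>Positive elements\<close>

text \<open>The real part in this definition is the whole spectral value, because the spectrum of a
  self-adjoint element is real.\<close>

definition positive :: "'a::unital_cstar_algebra \<Rightarrow> bool" where
  "positive p \<longleftrightarrow> star p = p \<and> (\<forall>c\<in>spec p. 0 \<le> Re c)"

lemma of_real_eq_scaleC: "(of_real r :: 'a::unital_cstar_algebra) = complex_of_real r *\<^sub>C 1"
  by (simp add: of_real_def scaleR_scaleC)

lemma star_of_real [simp]: "star (of_real r) = (of_real r :: 'a::unital_cstar_algebra)"
  by (simp add: of_real_eq_scaleC star_simps)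

text \<open>This criterion and its converse below turn positivity into an inequality between norms, which is
  visibly stable under sums.\<close>

lemma positiveI_norm:
  fixes p :: "'a::unital_cstar_algebra"
  assumes "star p = p" "norm (of_real t - p) \<le> t"
  shows "positive p"
  unfolding positive_def
proof (intro conjI ballI assms(1))
  fix c assume c: "c \<in> spec p"
  have "of_real t - c \<in> spec (of_real t - p)"
    using c unfolding of_real_eq_scaleC spec_scalar_diff by simp
  then have "cmod (of_real t - c) \<le> t" using spec_norm_le assms(2) by (metis order_trans)
  then show "0 \<le> Re c" using complex_Re_le_cmod[of "of_real t - c"] by simp
qed

lemma positiveD_norm:
  fixes p :: "'a::unital_cstar_algebra"
  assumes p: "positive p" and t: "norm p \<le> t"
  shows "norm (of_real t - p) \<le> t"
proof -
  have sa: "star (of_real t - p) = of_real t - p" using p by (simp add: positive_def star_diff)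
  obtain c where c: "c \<in> spec (of_real t - p)" "cmod c = norm (of_real t - p)"
    using spec_self_adjoint_attains_norm[OF sa] by blast
  have im: "Im c = 0" using spec_self_adjoint_real[OF sa c(1)] .
  have tc: "of_real t - c \<in> spec p" using c(1) unfolding of_real_eq_scaleC spec_scalar_diff .
  then have "Re c \<le> t" using p by (auto simp: positive_def)
  moreover have "cmod (of_real t - c) \<le> t" using spec_norm_le[OF tc] t by simp
  then have "0 \<le> Re c" using complex_Re_le_cmod[of "of_real t - c"] by simp
  moreover have "cmod c = \<bar>Re c\<bar>" using im by (simp add: cmod_eq_Re)
  ultimately show ?thesis using c(2) by simp
qed

lemma positive_zero [simp]: "positive (0::'a::unital_cstar_algebra)"
  by (rule positiveI_norm[of _ 0]) auto

lemma positive_add: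
  fixes p :: "'a::unital_cstar_algebra"
  assumes "positive p" "positive q"
  shows "positive (p + q)"
proof (rule positiveI_norm)
  show "star (p + q) = p + q" using assms by (simp add: positive_def star_add)
  have "of_real (norm p + norm q) - (p + q) = (of_real (norm p) - p) + (of_real (norm q) - q)" by simp
  also have "norm \<dots> \<le> norm p + norm q"
    by (intro norm_triangle_mono positiveD_norm assms order_refl)
  finally show "norm (of_real (norm p + norm q) - (p + q)) \<le> norm p + norm q" .
qed

lemma positive_scaleR:
  fixes p :: "'a::unital_cstar_algebra"
  assumes "positive p" "0 \<le> r"
  shows "positive (r *\<^sub>R p)"
proof (rule positiveI_norm)
  show "star (r *\<^sub>R p) = r *\<^sub>R p" using assms by (simp add: positive_def star_scaleR)
  have "of_real (r * norm p) - r *\<^sub>R p = r *\<^sub>R (of_real (norm p) - p)"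
    by (simp add: scaleR_diff_right of_real_def)
  also have "norm \<dots> \<le> r * norm p"
    using positiveD_norm[OF assms(1) order_refl] assms(2) by (simp add: mult_left_mono)
  finally show "norm (of_real (r * norm p) - r *\<^sub>R p) \<le> r * norm p" .
qed

lemma positive_sum:
  fixes f :: "'i \<Rightarrow> 'a::unital_cstar_algebra"
  assumes "\<And>i. i \<in> F \<Longrightarrow> positive (f i)"
  shows "positive (sum f F)"
  using assms by (induction F rule: infinite_finite_induct) (simp_all add: positive_add)

lemma positive_of_real_diff:
  fixes x :: "'a::unital_cstar_algebra"
  assumes "star x = x" "norm x \<le> t"
  shows "positive (of_real t - x)"
  by (rule positiveI_norm[of _ t]) (use assms in \<open>simp_all add: star_diff\<close>)

text \<open>As \<open>p + q \<le> \<parallel>p + q\<parallel>\<close>, also \<open>p \<le> \<parallel>p + q\<parallel>\<close>, and the norm of \<open>p\<close> is one of its spectral values.\<close>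

lemma positive_norm_mono:
  fixes p :: "'a::unital_cstar_algebra"
  assumes p: "positive p" and q: "positive q"
  shows "norm p \<le> norm (p + q)"
proof -
  have "positive (of_real (norm (p + q)) - (p + q))"
    by (rule positive_of_real_diff) (use positive_add[OF p q] in \<open>auto simp: positive_def\<close>)
  then have "positive ((of_real (norm (p + q)) - (p + q)) + q)" using q by (rule positive_add)
  then have pos: "positive (of_real (norm (p + q)) - p)" by simp
  obtain c where c: "c \<in> spec p" "cmod c = norm p"
    using spec_self_adjoint_attains_norm[of p] p by (auto simp: positive_def)
  have "Im c = 0" "0 \<le> Re c" using p c(1) spec_self_adjoint_real by (auto simp: positive_def)
  then have "Re c = norm p" using c(2) by (simp add: cmod_eq_Re)
  moreover have "of_real (norm (p + q)) - c \<in> spec (of_real (norm (p + q)) - p)"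
    using c(1) unfolding of_real_eq_scaleC spec_scalar_diff by simp
  ultimately show ?thesis using pos by (auto simp: positive_def)
qed

text \<open>For \<open>c < 0\<close> and \<open>m\<^sup>2 = c\<close> the element \<open>k\<^sup>2 - c = (k - m) (k + m)\<close> is invertible, because \<open>m\<close> is purely
  imaginary and the spectrum of \<open>k\<close> is real.\<close>

lemma positive_square:
  fixes k :: "'a::unital_cstar_algebra"
  assumes k: "star k = k"
  shows "positive (k * k)"
  unfolding positive_def
proof (intro conjI ballI)
  show sa: "star (k * k) = k * k" by (simp add: star_mult k)
  fix c assume c: "c \<in> spec (k * k)"
  have im: "Im c = 0" using spec_self_adjoint_real[OF sa c] .
  show "0 \<le> Re c"
  proof (rule ccontr)
    assume neg: "\<not> 0 \<le> Re c"
    define m where "m = \<i> * complex_of_real (sqrt (- Re c))"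
    have mm: "m * m = c" using neg im
      by (simp add: m_def complex_eq_iff)
    have Im: "Im m \<noteq> 0" using neg by (simp add: m_def)
    have "invertible_elt (k - m *\<^sub>C 1)" "invertible_elt (k - (- m) *\<^sub>C 1)"
      using spec_self_adjoint_real[OF k, of m] spec_self_adjoint_real[OF k, of "- m"] Im
      by (auto simp: spec_def)
    then obtain u v where u: "(k - m *\<^sub>C 1) * u = 1" "u * (k - m *\<^sub>C 1) = 1"
        and v: "(k + m *\<^sub>C 1) * v = 1" "v * (k + m *\<^sub>C 1) = 1"
      by (auto simp: invertible_elt_def)
    have f: "k * k - c *\<^sub>C 1 = (k - m *\<^sub>C 1) * (k + m *\<^sub>C 1)"
      by (simp add: algebra_simps scaleC_algebra mm)
    have "(k - m *\<^sub>C 1) * (k + m *\<^sub>C 1) * (v * u) = 1"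
      using u(1) v(1) by (metis mult.assoc mult.right_neutral)
    moreover have "(v * u) * ((k - m *\<^sub>C 1) * (k + m *\<^sub>C 1)) = 1"
      using u(2) v(2) by (metis mult.assoc mult.right_neutral)
    ultimately have "invertible_elt (k * k - c *\<^sub>C 1)" unfolding f by (rule invertible_eltI)
    then show False using c by (simp add: spec_def)
  qed
qed

text \<open>The equation says that \<open>(1 - r)\<^sup>2 = 1 - x\<close>. The iteration \<open>r \<mapsto> (x + r\<^sup>2) / 2\<close> from \<open>0\<close> converges, because
  its increments are dominated in norm by those of the scalar iteration \<open>\<rho> \<mapsto> (1 + \<rho>\<^sup>2) / 2\<close>, which is
  increasing and bounded by \<open>1\<close>. All iterates are polynomials in \<open>x\<close>.\<close>

lemma square_root_fixed_point:
  fixes x :: "'a::unital_cstar_algebra"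
  assumes x: "norm x \<le> 1"
  shows "\<exists>r. r + r = x + r * r \<and> norm r \<le> 1 \<and> (star x = x \<longrightarrow> star r = r) \<and>
     (\<forall>y. y * x = x * y \<longrightarrow> y * r = r * y)"
proof -
  define f where "f = rec_nat 0 (\<lambda>n r. (1/2) *\<^sub>R (x + r * r))"
  define \<rho> where "\<rho> = rec_nat (0::real) (\<lambda>n r. (1 + r * r) / 2)"
  have f: "f 0 = 0" "\<And>n. f (Suc n) = (1/2) *\<^sub>R (x + f n * f n)" by (simp_all add: f_def)
  have \<rho>: "\<rho> 0 = 0" "\<And>n. \<rho> (Suc n) = (1 + \<rho> n * \<rho> n) / 2" by (simp_all add: \<rho>_def)
  have \<rho>1: "0 \<le> \<rho> n \<and> \<rho> n \<le> 1" for n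
    by (induction n) (auto simp: \<rho> mult_le_one)
  have nf: "norm (f n) \<le> \<rho> n" for n
  proof (induction n)
    case (Suc n)
    have "norm (f n * f n) \<le> norm (f n) * norm (f n)" by (rule norm_mult_ineq)
    also have "\<dots> \<le> \<rho> n * \<rho> n" using Suc \<rho>1[of n] by (intro mult_mono) auto
    finally have "norm (x + f n * f n) \<le> 1 + \<rho> n * \<rho> n" using x by (rule norm_triangle_mono[rotated])
    then show ?case by (simp add: f \<rho>)
  qed (simp add: f \<rho>)
  have comm: "y * f n = f n * y" if y: "y * x = x * y" for y n
  proof (induction n)
    case (Suc n)
    have "y * (f n * f n) = f n * f n * y" by (metis Suc mult.assoc)
    then show ?case using y by (simp add: f algebra_simps)
  qed (simp add: f)
  have commf: "f m * f n = f n * f m" for m n using comm comm[of x m] by metis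
  have step: "norm (f (Suc n) - f n) \<le> \<rho> (Suc n) - \<rho> n" for n
  proof (induction n)
    case 0
    then show ?case using x by (simp add: f \<rho>)
  next
    case (Suc n)
    have "f (Suc (Suc n)) - f (Suc n) =
        (1/2) *\<^sub>R (x + f (Suc n) * f (Suc n)) - (1/2) *\<^sub>R (x + f n * f n)"
      using f(2)[of n] f(2)[of "Suc n"] by argo
    also have "\<dots> = (1/2) *\<^sub>R (f (Suc n) * f (Suc n) - f n * f n)"
      unfolding scaleR_diff_right[symmetric] by simp
    also have "\<dots> = (1/2) *\<^sub>R ((f (Suc n) + f n) * (f (Suc n) - f n))"
      using commf[of n "Suc n"] by (simp add: algebra_simps)
    finally have "norm (f (Suc (Suc n)) - f (Suc n)) \<le> 1/2 * (norm (f (Suc n) + f n) * norm (f (Suc n) - f n))"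
      using norm_mult_ineq by simp
    also have "\<dots> \<le> 1/2 * ((\<rho> (Suc n) + \<rho> n) * (\<rho> (Suc n) - \<rho> n))"
      using Suc nf[of n] nf[of "Suc n"] \<rho>1 norm_triangle_ineq[of "f (Suc n)" "f n"]
      by (intro mult_left_mono mult_mono) auto
    also have "\<dots> = \<rho> (Suc (Suc n)) - \<rho> (Suc n)"
    proof -
      have "\<rho> (Suc (Suc n)) - \<rho> (Suc n) = (1 + \<rho> (Suc n) * \<rho> (Suc n)) / 2 - (1 + \<rho> n * \<rho> n) / 2"
        by (rule arg_cong2[of _ _ _ _ "(-)"]) (rule \<rho>(2))+
      then show ?thesis by (simp only:) (simp add: field_simps)
    qed
    finally show ?case .
  qed
  have "\<rho> n \<le> \<rho> (Suc n)" for n using order_trans[OF norm_ge_zero step[of n]] by simp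
  then have "incseq \<rho>" by (rule incseq_SucI)
  moreover have "Bseq \<rho>" by (rule BseqI'[of _ 1]) (use \<rho>1 in simp)
  ultimately have "convergent \<rho>" by (simp add: Bseq_monoseq_convergent incseq_imp_monoseq)
  then have cau: "Cauchy \<rho>" by (rule convergent_Cauchy)
  have tele: "norm (f (n + k) - f n) \<le> \<rho> (n + k) - \<rho> n" for n k
  proof (induction k)
    case (Suc k)
    then show ?case using step[of "n + k"] norm_triangle_ineq[of "f (Suc (n + k)) - f (n + k)" "f (n + k) - f n"]
      by simp
  qed simp
  have "norm (f m - f n) \<le> \<bar>\<rho> m - \<rho> n\<bar>" for m n
    using tele[of n "m - n"] tele[of m "n - m"] by (cases "n \<le> m") (auto simp: norm_minus_commute)
  then have "Cauchy f" using cau unfolding Cauchy_def dist_norm real_norm_def by (meson le_less_trans)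
  then obtain r where r: "f \<longlonglongrightarrow> r" using Cauchy_convergent_iff convergent_def by blast
  have "(\<lambda>n. f (Suc n)) \<longlonglongrightarrow> (1/2) *\<^sub>R (x + r * r)" unfolding f by (intro tendsto_intros r)
  then have eq: "r = (1/2) *\<^sub>R (x + r * r)" using LIMSEQ_Suc[OF r] LIMSEQ_unique by blast
  have "2 *\<^sub>R ((1/2) *\<^sub>R (x + r * r)) = x + r * r" by simp
  then have 1: "r + r = x + r * r" using eq by (metis scaleR_2)
  have 2: "norm r \<le> 1"
    by (rule LIMSEQ_le_const2[OF tendsto_norm[OF r]]) (use nf \<rho>1 order_trans in blast)
  have 3: "star r = r" if "star x = x"
  proof -
    have "star (f n) = f n" for n using that by (induction n) (simp_all add: f star_simps)
    moreover have "(\<lambda>n. star (f n)) \<longlonglongrightarrow> star r"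
    proof -
      have "(\<lambda>n. norm (f n - r)) \<longlonglongrightarrow> 0" using r by (simp add: LIM_zero tendsto_norm_zero)
      moreover have "norm (f n - r) = norm (star (f n) - star r)" for n
        by (simp flip: star_diff)
      ultimately show ?thesis using LIM_zero_cancel tendsto_norm_zero_cancel by fastforce
    qed
    ultimately show ?thesis using r LIMSEQ_unique by simp
  qed
  have 4: "y * r = r * y" if "y * x = x * y" for y
  proof -
    have "(\<lambda>n. y * f n) \<longlonglongrightarrow> y * r" "(\<lambda>n. f n * y) \<longlonglongrightarrow> r * y" by (intro tendsto_intros r)+
    then show ?thesis using comm[OF that] LIMSEQ_unique by fastforce
  qed
  show ?thesis by (intro exI[of _ r] conjI allI impI 1 2 3 4)
qed

lemma positive_square_root:
  fixes p :: "'a::unital_cstar_algebra"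
  assumes p: "positive p"
  obtains q where "positive q" "q * q = p" "\<And>y. y * p = p * y \<Longrightarrow> y * q = q * y"
proof (cases "p = 0")
  case True
  then show ?thesis by (intro that[of 0]) auto
next
  case False
  \<comment> \<open>Scaling by \<open>t\<close> makes \<open>1 - p / t\<close> a contraction, to which the fixed point equation applies.\<close>
  define t where "t = norm p"
  have t: "t > 0" using False by (simp add: t_def)
  define x where "x = 1 - (1/t) *\<^sub>R p"
  have "x = (1/t) *\<^sub>R (of_real t - p)" using t by (simp add: x_def scaleR_diff_right of_real_def)
  then have "norm x = norm (of_real t - p) / t" using t by simp
  also have "\<dots> \<le> 1" using positiveD_norm[OF p, of t] t by (simp add: t_def)
  finally obtain r where r: "r + r = x + r * r" "norm r \<le> 1" "star x = x \<Longrightarrow> star r = r"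
      "\<And>y. y * x = x * y \<Longrightarrow> y * r = r * y"
    using square_root_fixed_point[of x] by blast
  have "star x = x" using p by (simp add: x_def star_simps positive_def)
  then have sr: "star r = r" by (rule r(3))
  have "positive (1 - r)" using positive_of_real_diff[of r 1] sr r(2) by simp
  have "(1 - r) * (1 - r) = 1 - (r + r) + r * r" by (simp add: algebra_simps)
  then have sq: "(1 - r) * (1 - r) = (1/t) *\<^sub>R p" unfolding r(1) by (simp add: x_def)
  show ?thesis
  proof (rule that)
    show "positive (sqrt t *\<^sub>R (1 - r))" using \<open>positive (1 - r)\<close> t by (intro positive_scaleR) auto
    show "sqrt t *\<^sub>R (1 - r) * (sqrt t *\<^sub>R (1 - r)) = p"
      using t by (simp add: sq)
    show "y * (sqrt t *\<^sub>R (1 - r)) = sqrt t *\<^sub>R (1 - r) * y" if "y * p = p * y" for y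
    proof -
      have "y * x = x * y" using that by (simp add: x_def right_diff_distrib left_diff_distrib)
      then show ?thesis using r(4)[of y] by (simp add: right_diff_distrib left_diff_distrib)
    qed
  qed
qed

text \<open>The elements \<open>h\<close> and \<open>k\<close> are the real part of \<open>y\<close> and, up to sign, its imaginary part.\<close>

lemma star_mult_add_mult_star:
  fixes y :: "'a::unital_cstar_algebra"
  obtains h k where "star h = h" "star k = k" "y * star y + star y * y = 2 *\<^sub>R (h * h + k * k)"
proof -
  define h where "h = (1/2) *\<^sub>R (y + star y)"
  define k where "k = (\<i> / 2) *\<^sub>C (y - star y)"
  have h: "star h = h" by (simp add: h_def star_simps add.commute)
  have k: "star k = k" by (simp add: k_def star_simps scaleC_diff_right)
  have "4 *\<^sub>R (h * h) = (y + star y) * (y + star y)" by (simp add: h_def)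
  moreover have "4 *\<^sub>R (k * k) = - ((y - star y) * (y - star y))"
    by (simp add: k_def scaleR_scaleC scaleC_mult_left scaleC_mult_right scaleC_scaleC)
  ultimately have "4 *\<^sub>R (h * h + k * k) = 2 *\<^sub>R (y * star y + star y * y)"
    by (simp add: algebra_simps scaleR_2)
  then have "(1/2) *\<^sub>R (4 *\<^sub>R (h * h + k * k)) = y * star y + star y * y" by simp
  then have "y * star y + star y * y = 2 *\<^sub>R (h * h + k * k)" by simp
  then show ?thesis by (rule that[OF h k])
qed

text \<open>If \<open>y\<^sup>* y \<le> 0\<close>, then \<open>y y\<^sup>* = 2 (h\<^sup>2 + k\<^sup>2) - y\<^sup>* y \<ge> 0\<close>. Since \<open>y\<^sup>* y\<close> and \<open>y y\<^sup>*\<close> have the same nonzero spectrum,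
  that spectrum is empty.\<close>

lemma star_mult_self_not_negative:
  fixes y :: "'a::unital_cstar_algebra"
  assumes neg: "positive (- (star y * y))"
  shows "y = 0"
proof -
  obtain h k where hk: "star h = h" "star k = k" "y * star y + star y * y = 2 *\<^sub>R (h * h + k * k)"
    by (rule star_mult_add_mult_star)
  have "positive (2 *\<^sub>R (h * h + k * k) + - (star y * y))"
    by (intro positive_add positive_scaleR positive_square hk neg) simp
  then have pos: "positive (y * star y)" by (simp flip: hk(3))
  have sa: "star (star y * y) = star y * y" by (simp add: star_simps)
  obtain c where c: "c \<in> spec (star y * y)" "cmod c = norm (star y * y)"
    using spec_self_adjoint_attains_norm[OF sa] by blast
  have "c = 0"
  proof (rule ccontr)
    assume "c \<noteq> 0"
    then have "0 \<le> Re c" using spec_mult_commute[OF c(1)] pos by (auto simp: positive_def)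
    moreover have "- c \<in> spec (- (star y * y))" using c(1) by (simp add: spec_minus)
    then have "Re c \<le> 0" using neg by (fastforce simp: positive_def)
    ultimately show False using \<open>c \<noteq> 0\<close> spec_self_adjoint_real[OF sa c(1)] by (simp add: complex_eq_iff)
  qed
  then show ?thesis using c(2) by simp
qed

text \<open>Kaplansky's argument: with \<open>b = x\<^sup>* x\<close> and \<open>m = (b\<^sup>2)\<^sup>1\<^sup>/\<^sup>2\<close>, the element \<open>n = m - b\<close> is twice the negative part
  of \<open>b\<close>, and \<open>(x n)\<^sup>* (x n) = n b n = - n m n \<le> 0\<close>. Hence \<open>x n = 0\<close>, which forces \<open>n = 0\<close>, so that
  \<open>b = m\<close> is positive.\<close>

theorem positive_star_mult_self:
  fixes x :: "'a::unital_cstar_algebra"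
  shows "positive (star x * x)"
proof -
  define b where "b = star x * x"
  have b: "star b = b" by (simp add: b_def star_simps)
  obtain m where m: "positive m" "m * m = b * b" and mc: "\<And>y. y * (b * b) = (b * b) * y \<Longrightarrow> y * m = m * y"
    using positive_square_root[OF positive_square[OF b]] by metis
  obtain s where s: "positive s" "s * s = m" and sc: "\<And>y. y * m = m * y \<Longrightarrow> y * s = s * y"
    using positive_square_root[OF m(1)] by metis
  have bm: "b * m = m * b" by (rule mc) (simp add: mult.assoc)
  define n where "n = m - b"
  have sm: "star m = m" and ss: "star s = s" using m s by (simp_all add: positive_def)
  have n: "star n = n" by (simp add: n_def star_simps b sm)
  have ns: "n * s = s * n" by (rule sc) (simp add: n_def algebra_simps bm)
  have mn: "m * n = n * m" by (simp add: n_def algebra_simps bm)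
  have bn: "b * n = - (m * n)" using m(2) bm by (simp add: n_def algebra_simps)
  have nmn: "n * (m * n) = (s * n) * (s * n)"
    by (metis ns s(2) mult.assoc)
  have sn: "star (s * n) = s * n" by (simp add: star_simps n ss ns)
  have yy: "star (x * n) * (x * n) = - ((s * n) * (s * n))"
  proof -
    have "star (x * n) * (x * n) = n * (b * n)" by (simp add: star_simps n b_def mult.assoc)
    then show ?thesis using nmn by (simp add: bn)
  qed
  have "x * n = 0"
    by (rule star_mult_self_not_negative) (simp add: yy positive_square[OF sn])
  then have "n * (m * n) = 0" using nmn yy by simp
  moreover have "n * n = m * n + m * n"
  proof -
    have "n * n = m * n - b * n" by (simp add: n_def left_diff_distrib)
    then show ?thesis by (simp add: bn)
  qed
  ultimately have "n * (n * n) = 0" by (simp add: distrib_left)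
  then have "(n * n) * (n * n) = 0" by (simp add: mult.assoc)
  then have "n * n = 0" using norm_self_adjoint_square[of "n * n"] by (simp add: star_simps n)
  then have "n = 0" using norm_self_adjoint_square[OF n] by simp
  then show ?thesis using m(1) by (simp add: n_def b_def)
qed

lemma positive_conjugate:
  assumes "positive p"
  shows "positive (star x * p * x)"
proof -
  obtain q where "positive q" "q * q = p" using positive_square_root[OF assms] by metis
  then have "star x * p * x = star (q * x) * (q * x)"
    by (auto simp: star_mult positive_def mult.assoc)
  then show ?thesis by (simp add: positive_star_mult_self)
qed

lemma positive_norm_diff_mono:
  assumes "positive p" "positive (q - p)"
  shows "norm p \<le> norm q"
  using positive_norm_mono[OF assms] by simp

section \<open>Automorphisms and simplicity\<close>

lemma star_automorphism_one:
  assumes "star_automorphism \<phi>"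
  shows "\<phi> 1 = 1"
proof -
  obtain e where "\<phi> e = 1"
    using assms by (metis star_automorphism_def bij_def surjD)
  moreover have "\<phi> (1 * e) = \<phi> 1 * \<phi> e" using assms unfolding star_automorphism_def by blast
  ultimately show ?thesis by simp
qed

text \<open>Homomorphisms shrink spectra, and the norm of the self-adjoint element \<open>x\<^sup>* x\<close> can be read off from
  its spectrum.\<close>

lemma star_automorphism_norm_le:
  fixes \<phi> :: "'a::unital_cstar_algebra \<Rightarrow> 'a"
  assumes \<phi>: "star_automorphism \<phi>"
  shows "norm (\<phi> x) \<le> norm x"
proof -
  have add: "\<phi> (u + v) = \<phi> u + \<phi> v" and mult: "\<phi> (u * v) = \<phi> u * \<phi> v"
    and scl: "\<phi> (c *\<^sub>C u) = c *\<^sub>C \<phi> u" and st: "\<phi> (star u) = star (\<phi> u)" for u v c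
    using \<phi> by (auto simp: star_automorphism_def)
  have one: "\<phi> 1 = 1" by (rule star_automorphism_one[OF \<phi>])
  have diff: "\<phi> (u - c *\<^sub>C 1) = \<phi> u - c *\<^sub>C 1" for u c
    using add[of u "(- c) *\<^sub>C 1"] scl[of "- c" 1] by (simp add: one)
  have spec: "spec (\<phi> u) \<subseteq> spec u" for u
  proof
    fix c assume c: "c \<in> spec (\<phi> u)"
    show "c \<in> spec u"
    proof (rule ccontr)
      assume "c \<notin> spec u"
      then obtain y where "(u - c *\<^sub>C 1) * y = 1" "y * (u - c *\<^sub>C 1) = 1"
        by (auto simp: spec_def invertible_elt_def)
      then have "(\<phi> u - c *\<^sub>C 1) * \<phi> y = 1" "\<phi> y * (\<phi> u - c *\<^sub>C 1) = 1"
        by (metis diff mult one)+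
      then show False using c by (auto simp: spec_def invertible_elt_def)
    qed
  qed
  have "star (star (\<phi> x) * \<phi> x) = star (\<phi> x) * \<phi> x" by (simp add: star_simps)
  then obtain c where c: "c \<in> spec (star (\<phi> x) * \<phi> x)" "cmod c = norm (star (\<phi> x) * \<phi> x)"
    using spec_self_adjoint_attains_norm by blast
  have "c \<in> spec (star x * x)" using spec[of "star x * x"] c(1) by (auto simp: mult st)
  then have "norm (star (\<phi> x) * \<phi> x) \<le> norm (star x * x)" using spec_norm_le c(2) by metis
  then show ?thesis by (simp add: cstar_identity)
qed

lemma closed_ideal_closure:
  fixes J :: "'a::unital_cstar_algebra set"
  assumes "0 \<in> J" "\<And>x y. x \<in> J \<Longrightarrow> y \<in> J \<Longrightarrow> x + y \<in> J"
    and "\<And>x a. x \<in> J \<Longrightarrow> a * x \<in> J" "\<And>x a. x \<in> J \<Longrightarrow> x * a \<in> J"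
  shows "closed_ideal (closure J)"
  unfolding closed_ideal_def
proof (intro conjI ballI allI)
  show "closed (closure J)" "0 \<in> closure J" using assms(1) closure_subset by auto
  fix x assume "x \<in> closure J"
  then obtain f where f: "\<And>n. f n \<in> J" "f \<longlonglongrightarrow> x" by (auto simp: closure_sequential)
  show "a * x \<in> closure J" for a
    unfolding closure_sequential
    by (intro exI[of _ "\<lambda>n. a * f n"] conjI allI assms f tendsto_intros)
  show "x * a \<in> closure J" for a
    unfolding closure_sequential
    by (intro exI[of _ "\<lambda>n. f n * a"] conjI allI assms f tendsto_intros)
  fix y assume "y \<in> closure J"
  then obtain g where g: "\<And>n. g n \<in> J" "g \<longlonglongrightarrow> y" by (auto simp: closure_sequential)
  show "x + y \<in> closure J"
    unfolding closure_sequential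
    by (intro exI[of _ "\<lambda>n. f n + g n"] conjI allI assms f g tendsto_intros)
qed

text \<open>For a spectral value \<open>c\<close> of \<open>z\<close>, the central element \<open>w = z - c\<close> generates the closed ideal
  \<open>closure (w A)\<close>. If this is all of \<open>A\<close>, some \<open>w a\<close> is close to \<open>1\<close>, so \<open>w\<close> is invertible, contrary to the
  choice of \<open>c\<close>. So it is \<open>{0}\<close>.\<close>

lemma simple_central_self_adjoint:
  fixes z :: "'a::unital_cstar_algebra"
  assumes simple: "simple_cstar TYPE('a)" and central: "\<And>x. z * x = x * z" and sa: "star z = z"
  shows "\<exists>r. z = of_real r"
proof -
  obtain c where c: "c \<in> spec z" using spec_self_adjoint_attains_norm[OF sa] by blast
  define w where "w = z - c *\<^sub>C 1"
  have w: "w * x = x * w" for x using central by (simp add: w_def algebra_simps scaleC_algebra)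
  have "closed_ideal (closure (range ((*) w)))"
  proof (rule closed_ideal_closure)
    show "0 \<in> range ((*) w)" by (metis mult_zero_right rangeI)
    show "x + y \<in> range ((*) w)" if "x \<in> range ((*) w)" "y \<in> range ((*) w)" for x y
      using that by (auto simp flip: distrib_left)
    show "a * x \<in> range ((*) w)" if x: "x \<in> range ((*) w)" for a x
    proof -
      obtain b where "x = w * b" using x by auto
      then have "a * x = w * (a * b)" by (simp add: mult.assoc w[of "a * b"] w[of b])
      then show ?thesis by simp
    qed
    show "x * a \<in> range ((*) w)" if "x \<in> range ((*) w)" for a x
      using that by (auto simp: mult.assoc)
  qed
  then have "closure (range ((*) w)) = {0} \<or> closure (range ((*) w)) = UNIV"
    using simple by (auto simp: simple_cstar_def)
  then have "w = 0"
  proof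
    assume "closure (range ((*) w)) = {0}"
    moreover have "w * 1 \<in> closure (range ((*) w))" by (meson closure_subset rangeI subsetD)
    ultimately show "w = 0" by simp
  next
    assume "closure (range ((*) w)) = UNIV"
    then have "1 \<in> closure (range ((*) w))" by simp
    then obtain a where "norm (1 - w * a) < 1"
      by (auto simp: closure_approachable dist_norm norm_minus_commute dest: spec[of _ 1])
    then have "invertible_elt (w * a)" using invertible_elt_one_minus by fastforce
    then obtain y where y: "w * a * y = 1" "y * (w * a) = 1" by (auto simp: invertible_elt_def)
    have "w * (a * y) = 1" "(a * y) * w = 1" using y(1) w[of "a * y"] by (simp_all add: mult.assoc)
    then have "invertible_elt w" by (rule invertible_eltI)
    then show "w = 0" using c by (simp add: spec_def w_def)
  qed
  then have "z = c *\<^sub>C 1" by (simp add: w_def)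
  moreover have "c = of_real (Re c)" using spec_self_adjoint_real[OF sa c] by (simp add: complex_eq_iff)
  ultimately show ?thesis by (metis of_real_eq_scaleC)
qed

section \<open>Outer actions have no intertwiners\<close>

lemma cstar_action_zero:
  assumes "cstar_action \<alpha>"
  shows "\<alpha> 0 a = a"
proof -
  have "\<alpha> 0 (\<alpha> 0 a) = \<alpha> (0 + 0) a" using assms unfolding cstar_action_def by (metis comp_apply)
  moreover have "inj (\<alpha> 0)" using assms by (simp add: cstar_action_def star_automorphism_def bij_def)
  ultimately show ?thesis by (simp add: inj_eq)
qed

lemma cstar_action_add: "cstar_action \<alpha> \<Longrightarrow> \<alpha> (g + h) a = \<alpha> g (\<alpha> h a)"
  by (simp add: cstar_action_def)

lemma cstar_action_minus:
  assumes "cstar_action \<alpha>"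
  shows "\<alpha> g (\<alpha> (- g) a) = a" "\<alpha> (- g) (\<alpha> g a) = a"
  using assms by (simp_all add: cstar_action_zero flip: cstar_action_add)

lemma cstar_action_hom:
  assumes "cstar_action \<alpha>"
  shows "\<alpha> g (a + b) = \<alpha> g a + \<alpha> g b" "\<alpha> g (c *\<^sub>C a) = c *\<^sub>C \<alpha> g a"
    "\<alpha> g (a * b) = \<alpha> g a * \<alpha> g b" "\<alpha> g (star a) = star (\<alpha> g a)" "\<alpha> g 1 = 1"
    "norm (\<alpha> g a) \<le> norm a"
  using assms by (auto simp: cstar_action_def star_automorphism_def
      intro: star_automorphism_one star_automorphism_norm_le)

lemma cstar_action_hom_zero:
  assumes "cstar_action \<alpha>"
  shows "\<alpha> g 0 = (0::'a::unital_cstar_algebra)"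
  using cstar_action_hom(2)[OF assms, of g 0 0] by simp

text \<open>Both \<open>t\<^sup>* t\<close> and \<open>t t\<^sup>*\<close> commute with the ranges of \<open>\<alpha>\<^bsub>- g\<^esub>\<close> and \<open>\<alpha>\<^bsub>- h\<^esub>\<close>, which are all of \<open>A\<close>. So they are
  scalars, and equal ones because \<open>t (t\<^sup>* t) = (t t\<^sup>*) t\<close>. If \<open>t \<noteq> 0\<close>, then \<open>t\<close> is a multiple of a unitary \<open>u\<close>,
  and \<open>x \<mapsto> u x\<close> is an isomorphism from \<open>\<^sub>gA\<close> to \<open>\<^sub>hA\<close>.\<close>

lemma outer_intertwiner_zero:
  fixes \<alpha> :: "'g::group_add \<Rightarrow> 'a::unital_cstar_algebra \<Rightarrow> 'a"
  assumes simple: "simple_cstar TYPE('a)" and act: "cstar_action \<alpha>" and outer: "outer_action \<alpha>"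
    and "g \<noteq> h" and t: "\<And>a. t * \<alpha> (- g) a = \<alpha> (- h) a * t"
  shows "t = 0"
proof (rule ccontr)
  assume "t \<noteq> 0"
  have t': "star t * \<alpha> (- h) a = \<alpha> (- g) a * star t" for a
    using arg_cong[OF t[of "star a"], of star] by (simp add: star_simps cstar_action_hom[OF act])
  have surj: "\<exists>b. \<alpha> k b = a" for k a using cstar_action_minus[OF act] by blast
  have scalar: "\<exists>r. s * u = of_real r"
    if s: "\<And>a. s * \<alpha> k a = \<alpha> l a * s" and u: "\<And>a. u * \<alpha> l a = \<alpha> k a * u" and sa: "star (s * u) = s * u"
    for s u :: 'a and k l
  proof (rule simple_central_self_adjoint[OF simple _ sa])
    fix x
    obtain b where "x = \<alpha> l b" using surj by metis
    then show "s * u * x = x * (s * u)" using s[of b] u[of b] by (metis mult.assoc)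
  qed
  obtain r where r: "star t * t = of_real r"
    using scalar[OF t' t] by (auto simp: star_simps)
  obtain r' where r': "t * star t = of_real r'"
    using scalar[OF t t'] by (auto simp: star_simps)
  have "t * (star t * t) = (t * star t) * t" by (simp add: mult.assoc)
  then have "r *\<^sub>R t = r' *\<^sub>R t" unfolding r r' by (simp add: of_real_def)
  then have rr: "r' = r" using \<open>t \<noteq> 0\<close> by simp
  have r0: "r \<noteq> 0" using r \<open>t \<noteq> 0\<close> by auto
  have "complex_of_real r \<in> spec (star t * t)"
    unfolding r of_real_eq_scaleC spec_def by (simp add: invertible_elt_def)
  then have "0 \<le> r" using positive_star_mult_self[of t] by (auto simp: positive_def)
  with r0 have rpos: "r > 0" by simp
  define u where "u = (1 / sqrt r) *\<^sub>R t"
  have u1: "star u * u = 1" and u2: "u * star u = 1"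
    using rpos r r' rr by (simp_all add: u_def star_scaleR of_real_def)
  have "twisted_bimodules_isomorphic \<alpha> g h"
    unfolding twisted_bimodules_isomorphic_def
  proof (intro exI[of _ "(*) u"] conjI allI)
    show "bij ((*) u)"
      by (rule bij_betw_byWitness[where f' = "(*) (star u)"]) (use u1 u2 in \<open>auto simp flip: mult.assoc\<close>)
    show "star (u * x) * (u * y) = star x * y" for x y
    proof -
      have "star (u * x) * (u * y) = star x * (star u * u) * y" by (simp add: star_mult mult.assoc)
      then show ?thesis by (simp add: u1)
    qed
    show "u * (\<alpha> (- g) a * x * c) = \<alpha> (- h) a * (u * x) * c" for a x c
    proof -
      have "u * \<alpha> (- g) a = \<alpha> (- h) a * u" using t[of a] by (simp add: u_def)
      then show ?thesis by (metis mult.assoc)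
    qed
  qed (simp_all add: distrib_left scaleC_mult_right)
  then show False using outer \<open>g \<noteq> h\<close> by (simp add: outer_action_def)
qed

section \<open>Sums of positive elements\<close>

lemma summable_on_Cauchy_tails:
  fixes f :: "'i \<Rightarrow> 'b::banach"
  shows "f summable_on UNIV \<longleftrightarrow>
    (\<forall>e>0. \<exists>F0. finite F0 \<and> (\<forall>F. finite F \<longrightarrow> F \<inter> F0 = {} \<longrightarrow> norm (sum f F) < e))"
proof (intro iffI allI impI)
  fix e :: real assume "f summable_on UNIV" "e > 0"
  then have "(f has_sum infsum f UNIV) UNIV" by simp
  then have "eventually (\<lambda>F. dist (sum f F) (infsum f UNIV) < e / 2) (finite_subsets_at_top UNIV)"
    using \<open>e > 0\<close> unfolding has_sum_def by (intro tendstoD) auto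
  then obtain F0 where F0: "finite F0" "\<And>F. finite F \<Longrightarrow> F0 \<subseteq> F \<Longrightarrow> dist (sum f F) (infsum f UNIV) < e / 2"
    unfolding eventually_finite_subsets_at_top by auto
  have "norm (sum f F) < e" if "finite F" "F \<inter> F0 = {}" for F
  proof -
    have "sum f F = sum f (F \<union> F0) - sum f F0" using that F0(1) by (simp add: sum.union_disjoint)
    then show ?thesis
      using F0(2)[of "F \<union> F0"] F0(2)[of F0] F0(1) that(1)
        dist_triangle_half_l[of "sum f (F \<union> F0)" "infsum f UNIV" e "sum f F0"]
      by (simp add: dist_norm)
  qed
  then show "\<exists>F0. finite F0 \<and> (\<forall>F. finite F \<longrightarrow> F \<inter> F0 = {} \<longrightarrow> norm (sum f F) < e)"
    using F0(1) by blast
next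
  assume cau: "\<forall>e>0. \<exists>F0. finite F0 \<and> (\<forall>F. finite F \<longrightarrow> F \<inter> F0 = {} \<longrightarrow> norm (sum f F) < e)"
  have "\<exists>P. eventually P (finite_subsets_at_top UNIV) \<and> (\<forall>F F'. P F \<and> P F' \<longrightarrow> dist (sum f F) (sum f F') < e)"
    if e: "e > 0" for e
  proof -
    obtain F0 where F0: "finite F0" "\<And>F. finite F \<Longrightarrow> F \<inter> F0 = {} \<Longrightarrow> norm (sum f F) < e / 2"
      using cau e by (metis half_gt_zero)
    have near: "dist (sum f F) (sum f F0) < e / 2" if "finite F" "F0 \<subseteq> F" for F
      using F0(2)[of "F - F0"] that F0(1) by (simp add: dist_norm sum_diff Diff_Int_distrib2)
    have "eventually (\<lambda>F. finite F \<and> F0 \<subseteq> F) (finite_subsets_at_top UNIV)"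
      using F0(1) by (auto simp: eventually_finite_subsets_at_top)
    moreover have "dist (sum f F) (sum f F') < e"
      if "finite F \<and> F0 \<subseteq> F" "finite F' \<and> F0 \<subseteq> F'" for F F'
      using near[of F] near[of F'] that dist_triangle_half_l by blast
    ultimately show ?thesis by blast
  qed
  then have "cauchy_filter (filtermap (sum f) (finite_subsets_at_top UNIV))"
    unfolding cauchy_filter_metric_filtermap by blast
  then obtain l where "filtermap (sum f) (finite_subsets_at_top UNIV) \<le> nhds l"
    using cauchy_filter_complete_converges[of "filtermap (sum f) (finite_subsets_at_top UNIV)" UNIV]
      complete_UNIV by (auto simp: filtermap_bot_iff)
  then show "f summable_on UNIV"
    by (auto simp: summable_on_def has_sum_def filterlim_def)
qed

text \<open>Monotonicity of the norm on positive elements dominates the tails of the sum of \<open>p\<close> by those of the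
  sum of \<open>q\<close>; neither sum need converge absolutely.\<close>

lemma summable_on_positive_comparison:
  fixes p q :: "'i \<Rightarrow> 'a::unital_cstar_algebra"
  assumes p: "\<And>i. positive (p i)" and pq: "\<And>i. positive (q i - p i)" and q: "q summable_on UNIV"
  shows "p summable_on UNIV" "norm (infsum p UNIV) \<le> norm (infsum q UNIV)"
proof -
  have le: "norm (sum p F) \<le> norm (sum q F)" for F
    using p pq by (intro positive_norm_diff_mono positive_sum) (auto intro!: positive_sum simp flip: sum_subtractf)
  show sp: "p summable_on UNIV"
    using q unfolding summable_on_Cauchy_tails by (meson le le_less_trans)
  have "(sum p \<longlongrightarrow> infsum p UNIV) (finite_subsets_at_top UNIV)"
    "(sum q \<longlongrightarrow> infsum q UNIV) (finite_subsets_at_top UNIV)"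
    using sp q by (simp_all flip: has_sum_def)
  then show "norm (infsum p UNIV) \<le> norm (infsum q UNIV)"
    by (intro tendsto_le[OF _ tendsto_norm tendsto_norm]) (auto simp: le)
qed

section \<open>Square-summable functions\<close>

definition delta :: "'g \<Rightarrow> ('g \<Rightarrow> 'a::unital_cstar_algebra)" where
  "delta g = (\<lambda>h. if h = g then 1 else 0)"

lemma delta_ip_has_sum: "((\<lambda>h. star (delta g h) * \<zeta> h) has_sum \<zeta> g) UNIV"
  by (rule has_sum_finite_neutralI[of "{g}"]) (auto simp: delta_def)

lemma l2_ip_delta: "l2_ip (delta g) \<zeta> = \<zeta> g"
  unfolding l2_ip_def by (rule infsumI[OF delta_ip_has_sum])

lemma delta_l2 [simp]: "delta g \<in> l2"
  unfolding l2_def mem_Collect_eq by (rule has_sum_imp_summable[OF delta_ip_has_sum])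

lemma l2_norm_delta: "l2_norm (delta g :: 'g \<Rightarrow> 'a::unital_cstar_algebra) = 1"
  by (simp add: l2_norm_def l2_ip_delta) (simp add: delta_def)

lemma l2_norm_nonneg: "0 \<le> l2_norm \<xi>"
  by (simp add: l2_norm_def)

lemma l2_norm_square: "(l2_norm \<xi>)\<^sup>2 = norm (l2_ip \<xi> \<xi>)"
  by (simp add: l2_norm_def)

text \<open>All estimates of the module norm are reduced to this pointwise comparison in \<open>A\<close>.\<close>

lemma l2_dominated:
  assumes \<xi>: "\<xi> \<in> l2" and c: "0 \<le> c"
    and dom: "\<And>g. positive (c\<^sup>2 *\<^sub>R (star (\<xi> g) * \<xi> g) - star (\<eta> g) * \<eta> g)"
  shows "\<eta> \<in> l2" "l2_norm \<eta> \<le> c * l2_norm \<xi>"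
proof -
  have sm: "(\<lambda>g. c\<^sup>2 *\<^sub>R (star (\<xi> g) * \<xi> g)) summable_on UNIV"
    using \<xi> by (intro summable_on_scaleR_right) (auto simp: l2_def)
  note cmp = summable_on_positive_comparison[where p = "\<lambda>g. star (\<eta> g) * \<eta> g" and
      q = "\<lambda>g. c\<^sup>2 *\<^sub>R (star (\<xi> g) * \<xi> g)", OF positive_star_mult_self dom sm]
  show "\<eta> \<in> l2" using cmp(1) by (simp add: l2_def)
  have "norm (l2_ip \<eta> \<eta>) \<le> c\<^sup>2 * norm (l2_ip \<xi> \<xi>)"
    using cmp(2) by (simp add: l2_ip_def infsum_scaleR_right)
  then have "(l2_norm \<eta>)\<^sup>2 \<le> (c * l2_norm \<xi>)\<^sup>2" by (simp add: l2_norm_square power_mult_distrib)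
  then show "l2_norm \<eta> \<le> c * l2_norm \<xi>"
    by (rule power2_le_imp_le) (use c in \<open>simp add: l2_norm_nonneg\<close>)
qed

lemma l2_zero [simp]: "0 \<in> l2"
  by (simp add: l2_def)

lemma l2_scaleC:
  assumes "\<xi> \<in> l2"
  shows "c *\<^sub>C \<xi> \<in> l2" "l2_norm (c *\<^sub>C \<xi>) \<le> cmod c * l2_norm \<xi>"
proof -
  have "star ((c *\<^sub>C \<xi>) g) * (c *\<^sub>C \<xi>) g = (cmod c)\<^sup>2 *\<^sub>R (star (\<xi> g) * \<xi> g)" for g
    unfolding scaleC_fun_def star_scaleC scaleC_mult_left scaleC_mult_right scaleC_scaleC scaleR_scaleC
      complex_norm_square mult.commute[of c] ..
  then have "positive ((cmod c)\<^sup>2 *\<^sub>R (star (\<xi> g) * \<xi> g) - star ((c *\<^sub>C \<xi>) g) * (c *\<^sub>C \<xi>) g)" for g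
    by simp
  then show "c *\<^sub>C \<xi> \<in> l2" "l2_norm (c *\<^sub>C \<xi>) \<le> cmod c * l2_norm \<xi>"
    using l2_dominated[OF assms norm_ge_zero] by blast+
qed

text \<open>Here \<open>c\<^sup>2 - b\<^sup>* b\<close> is positive and remains so after conjugation by \<open>\<xi>\<close>. This makes the covariant
  representation of \<open>A\<close> bounded.\<close>

lemma l2_left_mult:
  assumes \<xi>: "\<xi> \<in> l2" and b: "\<And>g. norm (b g) \<le> c"
  shows "(\<lambda>g. b g * \<xi> g) \<in> l2" "l2_norm (\<lambda>g. b g * \<xi> g) \<le> c * l2_norm \<xi>"
proof -
  have c: "0 \<le> c" using b norm_ge_zero order_trans by blast
  have "positive (c\<^sup>2 *\<^sub>R (star (\<xi> g) * \<xi> g) - star (b g * \<xi> g) * (b g * \<xi> g))" for g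
  proof -
    have "positive (of_real (c\<^sup>2) - star (b g) * b g)"
      by (rule positive_of_real_diff)
         (use b in \<open>simp_all add: star_simps cstar_identity power_mono\<close>)
    then have "positive (star (\<xi> g) * (of_real (c\<^sup>2) - star (b g) * b g) * \<xi> g)"
      by (rule positive_conjugate)
    then show ?thesis
      by (simp add: algebra_simps star_mult of_real_def del: of_real_power)
  qed
  then show "(\<lambda>g. b g * \<xi> g) \<in> l2" "l2_norm (\<lambda>g. b g * \<xi> g) \<le> c * l2_norm \<xi>"
    by (rule l2_dominated[OF \<xi> c])+
qed

text \<open>By the parallelogram law, \<open>2 \<xi>\<^sup>* \<xi> + 2 \<eta>\<^sup>* \<eta> - (\<xi> + \<eta>)\<^sup>* (\<xi> + \<eta>) = (\<xi> - \<eta>)\<^sup>* (\<xi> - \<eta>)\<close> is positive. The resulting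
  factor \<open>2\<close> is harmless where only arbitrarily small bounds matter.\<close>

lemma l2_add:
  assumes \<xi>: "\<xi> \<in> l2" and \<eta>: "\<eta> \<in> l2"
  shows "\<xi> + \<eta> \<in> l2" "l2_norm (\<xi> + \<eta>) \<le> 2 * (l2_norm \<xi> + l2_norm \<eta>)"
proof -
  have s1: "(\<lambda>g. 2 *\<^sub>R (star (\<xi> g) * \<xi> g)) summable_on UNIV"
    and s2: "(\<lambda>g. 2 *\<^sub>R (star (\<eta> g) * \<eta> g)) summable_on UNIV"
    using \<xi> \<eta> by (auto intro!: summable_on_scaleR_right simp: l2_def)
  have dom: "positive (2 *\<^sub>R (star (\<xi> g) * \<xi> g) + 2 *\<^sub>R (star (\<eta> g) * \<eta> g) -
      star ((\<xi> + \<eta>) g) * (\<xi> + \<eta>) g)" for g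
  proof -
    have "2 *\<^sub>R (star (\<xi> g) * \<xi> g) + 2 *\<^sub>R (star (\<eta> g) * \<eta> g) - star ((\<xi> + \<eta>) g) * (\<xi> + \<eta>) g
       = star (\<xi> g - \<eta> g) * (\<xi> g - \<eta> g)"
      by (simp add: star_simps algebra_simps scaleR_2)
    then show ?thesis by (simp add: positive_star_mult_self)
  qed
  note cmp = summable_on_positive_comparison[where p = "\<lambda>g. star ((\<xi> + \<eta>) g) * (\<xi> + \<eta>) g"
      and q = "\<lambda>g. 2 *\<^sub>R (star (\<xi> g) * \<xi> g) + 2 *\<^sub>R (star (\<eta> g) * \<eta> g)",
      OF positive_star_mult_self dom summable_on_add[OF s1 s2]]
  show "\<xi> + \<eta> \<in> l2" using cmp(1) by (simp add: l2_def)
  have "norm (l2_ip (\<xi> + \<eta>) (\<xi> + \<eta>)) \<le> norm (2 *\<^sub>R l2_ip \<xi> \<xi> + 2 *\<^sub>R l2_ip \<eta> \<eta>)"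
    using cmp(2) by (simp add: l2_ip_def infsum_add[OF s1 s2] infsum_scaleR_right)
  also have "\<dots> \<le> 2 * norm (l2_ip \<xi> \<xi>) + 2 * norm (l2_ip \<eta> \<eta>)"
    using norm_triangle_ineq[of "2 *\<^sub>R l2_ip \<xi> \<xi>" "2 *\<^sub>R l2_ip \<eta> \<eta>"] by simp
  also have "\<dots> \<le> (2 * (l2_norm \<xi> + l2_norm \<eta>))\<^sup>2"
    using l2_norm_nonneg[of \<xi>] l2_norm_nonneg[of \<eta>]
    by (simp add: power2_eq_square algebra_simps flip: l2_norm_square)
  finally show "l2_norm (\<xi> + \<eta>) \<le> 2 * (l2_norm \<xi> + l2_norm \<eta>)"
    using l2_norm_nonneg[of \<xi>] l2_norm_nonneg[of \<eta>]
    by (intro power2_le_imp_le[of "l2_norm (\<xi> + \<eta>)"]) (simp_all add: l2_norm_square)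
qed

lemma norm_coordinate_le_l2_norm:
  assumes "\<xi> \<in> l2"
  shows "norm (\<xi> g) \<le> l2_norm \<xi>"
proof -
  have s: "((\<lambda>h. if h = g then star (\<xi> g) * \<xi> g else 0) has_sum (star (\<xi> g) * \<xi> g)) UNIV"
    by (rule has_sum_finite_neutralI[of "{g}"]) auto
  have "norm (infsum (\<lambda>h. if h = g then star (\<xi> g) * \<xi> g else 0) UNIV) \<le> norm (l2_ip \<xi> \<xi>)"
    unfolding l2_ip_def using assms
    by (intro summable_on_positive_comparison(2)) (auto simp: l2_def positive_star_mult_self)
  then have "(norm (\<xi> g))\<^sup>2 \<le> (l2_norm \<xi>)\<^sup>2"
    by (simp add: infsumI[OF s] l2_norm_square cstar_identity)
  then show ?thesis by (rule power2_le_imp_le) (rule l2_norm_nonneg)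
qed

lemma l2_shift:
  assumes "\<xi> \<in> l2"
  shows "(\<lambda>g. \<xi> (- h + g :: 'g::group_add)) \<in> l2" "l2_norm (\<lambda>g. \<xi> (- h + g)) = l2_norm \<xi>"
proof -
  have b: "bij_betw ((+) (- h)) UNIV (UNIV :: 'g set)"
    by (rule bij_betw_byWitness[where f' = "(+) h"]) (auto simp: add.assoc[symmetric])
  show "(\<lambda>g. \<xi> (- h + g)) \<in> l2"
    using assms summable_on_reindex_bij_betw[OF b, of "\<lambda>g. star (\<xi> g) * \<xi> g"] by (simp add: l2_def)
  show "l2_norm (\<lambda>g. \<xi> (- h + g)) = l2_norm \<xi>"
    using infsum_reindex_bij_betw[OF b, of "\<lambda>g. star (\<xi> g) * \<xi> g"] by (simp add: l2_norm_def l2_ip_def)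
qed

lemma l2_ip_shift:
  fixes \<xi> \<eta> :: "'g::group_add \<Rightarrow> 'a::unital_cstar_algebra"
  shows "l2_ip (\<lambda>g. \<xi> (- h + g)) \<eta> = l2_ip \<xi> (\<lambda>g. \<eta> (h + g))"
proof -
  have b: "bij_betw ((+) h) UNIV (UNIV :: 'g set)"
    by (rule bij_betw_byWitness[where f' = "(+) (- h)"]) (auto simp: add.assoc[symmetric])
  show ?thesis
    using infsum_reindex_bij_betw[OF b, of "\<lambda>g. star (\<xi> (- h + g)) * \<eta> g"]
    by (simp add: l2_ip_def add.assoc[symmetric])
qed

lemma polarization:
  fixes x y :: "'a::unital_cstar_algebra"
  shows "star x * y = (1/4) *\<^sub>C (star (1 *\<^sub>C x + y) * (1 *\<^sub>C x + y))
      + (\<i>/4) *\<^sub>C (star (\<i> *\<^sub>C x + y) * (\<i> *\<^sub>C x + y))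
      + (-1/4) *\<^sub>C (star ((-1) *\<^sub>C x + y) * ((-1) *\<^sub>C x + y))
      + (-\<i>/4) *\<^sub>C (star ((-\<i>) *\<^sub>C x + y) * ((-\<i>) *\<^sub>C x + y))"
    (is "_ = ?R")
proof -
  have expand: "d *\<^sub>C (star (c *\<^sub>C x + y) * (c *\<^sub>C x + y)) = (d * cnj c * c) *\<^sub>C (star x * x)
      + (d * cnj c) *\<^sub>C (star x * y) + (d * c) *\<^sub>C (star y * x) + d *\<^sub>C (star y * y)" for c d
    by (simp add: star_simps distrib_left distrib_right scaleC_add_right scaleC_mult_left
        scaleC_mult_right scaleC_scaleC mult_ac)
  have "?R = (1/4 + \<i>/4 + -1/4 + -\<i>/4) *\<^sub>C (star x * x) + (1/4 + 1/4 + 1/4 + 1/4) *\<^sub>C (star x * y)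
      + (1/4 + -1/4 + 1/4 + -1/4) *\<^sub>C (star y * x) + (1/4 + \<i>/4 + -1/4 + -\<i>/4) *\<^sub>C (star y * y)"
    unfolding expand scaleC_add_left by simp
  then show ?thesis by simp
qed

text \<open>The summands are combinations of four functions of the form \<open>\<zeta>\<^sup>* \<zeta>\<close> with square-summable \<open>\<zeta>\<close>.\<close>

lemma l2_ip_summable:
  assumes "\<xi> \<in> l2" "\<eta> \<in> l2"
  shows "(\<lambda>g. star (\<xi> g) * \<eta> g) summable_on UNIV"
proof -
  have bl: "bounded_linear (\<lambda>x::'b::unital_cstar_algebra. c *\<^sub>C x)" for c
    by (rule bounded_linear_intro[of _ "cmod c"])
       (simp_all add: scaleC_add_right scaleR_scaleC scaleC_scaleC mult.commute norm_scaleC)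
  have sm: "(\<lambda>g. d *\<^sub>C (star ((c *\<^sub>C \<xi> + \<eta>) g) * (c *\<^sub>C \<xi> + \<eta>) g)) summable_on UNIV" for c d
    by (rule summable_on_bounded_linear[OF bl])
       (use l2_add(1)[OF l2_scaleC(1)[OF assms(1)] assms(2)] in \<open>simp add: l2_def\<close>)
  show ?thesis
    unfolding polarization[of "\<xi> _" "\<eta> _"] using sm
    by (intro summable_on_add) (simp_all only: scaleC_fun_def plus_fun_apply)
qed

lemma l2_ip_add_right:
  assumes "\<xi> \<in> l2" "\<eta> \<in> l2" "\<zeta> \<in> l2"
  shows "l2_ip \<xi> (\<eta> + \<zeta>) = l2_ip \<xi> \<eta> + l2_ip \<xi> \<zeta>"
  using infsum_add[OF l2_ip_summable l2_ip_summable] assms by (simp add: l2_ip_def distrib_left)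

lemma l2_ip_add_left:
  assumes "\<xi> \<in> l2" "\<eta> \<in> l2" "\<zeta> \<in> l2"
  shows "l2_ip (\<eta> + \<zeta>) \<xi> = l2_ip \<eta> \<xi> + l2_ip \<zeta> \<xi>"
  using infsum_add[OF l2_ip_summable l2_ip_summable] assms by (simp add: l2_ip_def distrib_right star_add)

section \<open>Adjointable operators\<close>

lemma l2_mapD: "l2_map T \<Longrightarrow> T \<xi> \<in> l2"
  unfolding l2_map_def by (cases "\<xi> \<in> l2") auto

lemma l2_map_add: "l2_map T \<Longrightarrow> l2_map S \<Longrightarrow> l2_map (T + S)"
  by (auto simp: l2_map_def l2_add)

lemma l2_map_scaleC: "l2_map T \<Longrightarrow> l2_map (c *\<^sub>C T)"
  by (auto simp: l2_map_def l2_scaleC scaleC_fun_def[of c T]) (simp add: scaleC_fun_def fun_eq_iff)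

lemma op_diff_eq: "T - S = T + (-1) *\<^sub>C (S :: ('g, 'a::unital_cstar_algebra) l2_op)"
  by (simp add: fun_eq_iff scaleC_fun_def)

lemma op_bounds_add:
  assumes "c \<in> op_bounds T" "d \<in> op_bounds S" "l2_map T" "l2_map S"
  shows "2 * (c + d) \<in> op_bounds (T + S)"
proof -
  have "l2_norm (T \<xi> + S \<xi>) \<le> 2 * (c + d) * l2_norm \<xi>" if \<xi>: "\<xi> \<in> l2" for \<xi>
  proof -
    have "l2_norm (T \<xi> + S \<xi>) \<le> 2 * (l2_norm (T \<xi>) + l2_norm (S \<xi>))"
      by (intro l2_add l2_mapD assms)
    also have "\<dots> \<le> 2 * (c * l2_norm \<xi> + d * l2_norm \<xi>)"
      using assms \<xi> by (intro mult_left_mono add_mono) (auto simp: op_bounds_def)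
    finally show ?thesis by (simp add: algebra_simps)
  qed
  then show ?thesis using assms by (auto simp: op_bounds_def)
qed

lemma op_bounds_scaleC:
  assumes "d \<in> op_bounds T" "l2_map T"
  shows "cmod c * d \<in> op_bounds (c *\<^sub>C T)"
proof -
  have "l2_norm (c *\<^sub>C T \<xi>) \<le> cmod c * d * l2_norm \<xi>" if \<xi>: "\<xi> \<in> l2" for \<xi>
  proof -
    have "l2_norm (c *\<^sub>C T \<xi>) \<le> cmod c * l2_norm (T \<xi>)" by (intro l2_scaleC l2_mapD assms)
    also have "\<dots> \<le> cmod c * (d * l2_norm \<xi>)"
      using assms \<xi> by (intro mult_left_mono) (auto simp: op_bounds_def)
    finally show ?thesis by (simp add: mult.assoc)
  qed
  then show ?thesis using assms by (auto simp: op_bounds_def scaleC_fun_def[of c T])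
qed

lemma op_bounds_comp:
  assumes "c \<in> op_bounds T" "d \<in> op_bounds S" "l2_map S"
  shows "c * d \<in> op_bounds (T \<circ> S)"
proof -
  have "l2_norm (T (S \<xi>)) \<le> c * d * l2_norm \<xi>" if \<xi>: "\<xi> \<in> l2" for \<xi>
  proof -
    have "l2_norm (T (S \<xi>)) \<le> c * l2_norm (S \<xi>)"
      using assms l2_mapD[OF assms(3)] by (auto simp: op_bounds_def)
    also have "\<dots> \<le> c * (d * l2_norm \<xi>)"
      using assms \<xi> by (intro mult_left_mono) (auto simp: op_bounds_def)
    finally show ?thesis by (simp add: mult.assoc)
  qed
  then show ?thesis using assms by (auto simp: op_bounds_def)
qed

text \<open>Norm estimates are carried out with explicit bounds, as these combine more easily than infima.\<close>

lemma op_norm_less_iff: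
  assumes "op_bounds T \<noteq> {}"
  shows "op_norm T < e \<longleftrightarrow> (\<exists>c\<in>op_bounds T. c < e)"
  unfolding op_norm_def
  by (rule cInf_less_iff[OF assms bdd_belowI[of _ 0]]) (simp add: op_bounds_def)

lemma is_l2_adjoint_unique:
  assumes "is_l2_adjoint T S" "is_l2_adjoint T S'"
  shows "S = S'"
proof (rule ext)
  fix \<eta>
  show "S \<eta> = S' \<eta>"
  proof (cases "\<eta> \<in> l2")
    case True
    then have "l2_ip (delta g) (S \<eta>) = l2_ip (delta g) (S' \<eta>)" for g
      using assms delta_l2 unfolding is_l2_adjoint_def by metis
    then show ?thesis by (simp add: l2_ip_delta fun_eq_iff)
  next
    case False
    then show ?thesis using assms by (simp add: is_l2_adjoint_def l2_map_def)
  qed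
qed

lemma l2_adj_eq:
  assumes "is_l2_adjoint T S"
  shows "l2_adj T = S"
  unfolding l2_adj_def by (rule the_equality[where P = "is_l2_adjoint T", OF assms is_l2_adjoint_unique[OF _ assms]])

lemma is_l2_adjoint_add:
  assumes "is_l2_adjoint T T'" "is_l2_adjoint S S'" "l2_map T" "l2_map S"
  shows "is_l2_adjoint (T + S) (T' + S')"
  using assms by (simp add: is_l2_adjoint_def l2_map_add l2_ip_add_left l2_ip_add_right l2_mapD)

lemma l2_ip_scaleC_left_right: "l2_ip (c *\<^sub>C \<xi>) \<eta> = l2_ip \<xi> (cnj c *\<^sub>C \<eta>)"
  by (simp add: l2_ip_def scaleC_fun_def star_scaleC scaleC_mult_left scaleC_mult_right)

lemma l2_ip_left_mult: "l2_ip (\<lambda>g. b g * \<xi> g) \<eta> = l2_ip \<xi> (\<lambda>g. star (b g) * \<eta> g)"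
  by (simp add: l2_ip_def star_mult mult.assoc)

lemma l2_ip_scaleC_right:
  fixes \<xi> \<eta> :: "'g \<Rightarrow> 'a::unital_cstar_algebra"
  assumes "\<xi> \<in> l2" "\<eta> \<in> l2"
  shows "l2_ip \<xi> (c *\<^sub>C \<eta>) = c *\<^sub>C l2_ip \<xi> \<eta>"
proof -
  have bl: "bounded_linear (\<lambda>x::'a. c *\<^sub>C x)"
    by (rule bounded_linear_intro[of _ "cmod c"])
       (simp_all add: scaleC_add_right scaleR_scaleC scaleC_scaleC mult.commute norm_scaleC)
  have "((\<lambda>g. star (\<xi> g) * \<eta> g) has_sum l2_ip \<xi> \<eta>) UNIV"
    unfolding l2_ip_def using l2_ip_summable[OF assms] by simp
  then have "((\<lambda>g. c *\<^sub>C (star (\<xi> g) * \<eta> g)) has_sum c *\<^sub>C l2_ip \<xi> \<eta>) UNIV"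
    by (rule has_sum_bounded_linear[OF bl])
  then show ?thesis
    unfolding l2_ip_def[of \<xi> "c *\<^sub>C \<eta>"] by (simp add: scaleC_fun_def scaleC_mult_right infsumI)
qed

lemma is_l2_adjoint_scaleC:
  assumes "is_l2_adjoint T S" and T: "l2_map T"
  shows "is_l2_adjoint (c *\<^sub>C T) (cnj c *\<^sub>C S)"
  unfolding is_l2_adjoint_def
proof (intro conjI ballI)
  show "l2_map (cnj c *\<^sub>C S)" using assms by (simp add: is_l2_adjoint_def l2_map_scaleC)
  fix \<xi> \<eta> :: "'a \<Rightarrow> 'b" assume "\<xi> \<in> l2" "\<eta> \<in> l2"
  moreover from this have "S \<eta> \<in> l2" "l2_ip (T \<xi>) \<eta> = l2_ip \<xi> (S \<eta>)"
    using assms by (auto simp: is_l2_adjoint_def l2_mapD)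
  ultimately show "l2_ip ((c *\<^sub>C T) \<xi>) \<eta> = l2_ip \<xi> ((cnj c *\<^sub>C S) \<eta>)"
    using T by (simp add: scaleC_fun_def[of c T] scaleC_fun_def[of "cnj c" S] l2_ip_scaleC_left_right
      l2_ip_scaleC_right l2_mapD)
qed

text \<open>Operators are total functions that send everything outside \<open>l2\<close> to \<open>0\<close>; a composition has this
  property as soon as the outer operator fixes \<open>0\<close>.\<close>

lemma l2_adjoint_zero:
  assumes "is_l2_adjoint T S" "l2_map T"
  shows "T 0 = 0" "S 0 = 0"
proof -
  have "l2_ip (T 0) (T 0) = l2_ip 0 (S (T 0))"
    using assms by (simp add: is_l2_adjoint_def l2_mapD)
  then have "l2_norm (T 0) = 0" by (simp add: l2_norm_def) (simp add: l2_ip_def)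
  then show "T 0 = 0"
    using norm_coordinate_le_l2_norm[OF l2_mapD[OF assms(2)], of 0] by (simp add: fun_eq_iff)
  have "l2_ip (delta g) (S 0) = l2_ip (T (delta g)) 0" for g
    using assms by (simp add: is_l2_adjoint_def)
  then show "S 0 = 0" by (simp add: l2_ip_delta fun_eq_iff) (simp add: l2_ip_def)
qed

lemma l2_map_comp: "l2_map T \<Longrightarrow> l2_map S \<Longrightarrow> T 0 = 0 \<Longrightarrow> l2_map (T \<circ> S)"
  by (auto simp: l2_map_def)

lemma is_l2_adjoint_comp:
  assumes "is_l2_adjoint T T'" "is_l2_adjoint S S'" "l2_map T" "l2_map S"
  shows "is_l2_adjoint (T \<circ> S) (S' \<circ> T')"
proof -
  have "l2_map (S' \<circ> T')"
    using assms l2_adjoint_zero(2)[of S S'] by (intro l2_map_comp) (auto simp: is_l2_adjoint_def)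
  then show ?thesis using assms by (simp add: is_l2_adjoint_def l2_mapD)
qed

section \<open>The reduced crossed product as an algebra of operators\<close>

lemma l2_map_diff: "l2_map T \<Longrightarrow> l2_map S \<Longrightarrow> l2_map (T - S)"
  unfolding op_diff_eq by (intro l2_map_add l2_map_scaleC)

lemma adjointable_opsI: "l2_map T \<Longrightarrow> c \<in> op_bounds T \<Longrightarrow> is_l2_adjoint T S \<Longrightarrow> T \<in> adjointable_ops"
  by (auto simp: adjointable_ops_def)

lemma adjointable_opsE:
  assumes "T \<in> adjointable_ops"
  obtains c S where "l2_map T" "c \<in> op_bounds T" "is_l2_adjoint T S"
  using assms by (auto simp: adjointable_ops_def)

lemma adjointable_ops_add:
  assumes "T \<in> adjointable_ops" "S \<in> adjointable_ops"
  shows "T + S \<in> adjointable_ops"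
proof -
  obtain c T' where T: "l2_map T" "c \<in> op_bounds T" "is_l2_adjoint T T'"
    using assms(1) by (rule adjointable_opsE)
  obtain d S' where S: "l2_map S" "d \<in> op_bounds S" "is_l2_adjoint S S'"
    using assms(2) by (rule adjointable_opsE)
  show ?thesis
    using l2_map_add op_bounds_add is_l2_adjoint_add T S by (metis adjointable_opsI)
qed

lemma adjointable_ops_scaleC:
  assumes "T \<in> adjointable_ops"
  shows "c *\<^sub>C T \<in> adjointable_ops"
proof -
  obtain d T' where T: "l2_map T" "d \<in> op_bounds T" "is_l2_adjoint T T'"
    using assms(1) by (rule adjointable_opsE)
  show ?thesis
    using l2_map_scaleC op_bounds_scaleC is_l2_adjoint_scaleC T by (metis adjointable_opsI)
qed

lemma adjointable_ops_diff:
  "T \<in> adjointable_ops \<Longrightarrow> S \<in> adjointable_ops \<Longrightarrow> T - S \<in> adjointable_ops"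
  unfolding op_diff_eq by (intro adjointable_ops_add adjointable_ops_scaleC)

lemma adjointable_ops_comp:
  assumes "T \<in> adjointable_ops" "S \<in> adjointable_ops"
  shows "T \<circ> S \<in> adjointable_ops"
proof -
  obtain c T' where T: "l2_map T" "c \<in> op_bounds T" "is_l2_adjoint T T'"
    using assms(1) by (rule adjointable_opsE)
  obtain d S' where S: "l2_map S" "d \<in> op_bounds S" "is_l2_adjoint S S'"
    using assms(2) by (rule adjointable_opsE)
  have "T 0 = 0" using l2_adjoint_zero T by blast
  then show ?thesis
    using l2_map_comp op_bounds_comp is_l2_adjoint_comp T S by (metis adjointable_opsI)
qed

lemma zero_adjointable [simp]: "0 \<in> adjointable_ops"
proof -
  have ip0: "l2_ip \<xi> 0 = 0" "l2_ip 0 \<xi> = 0" for \<xi> :: "'a \<Rightarrow> 'b" by (simp_all add: l2_ip_def)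
  have m: "l2_map (0 :: ('a, 'b) l2_op)" by (simp add: l2_map_def)
  show ?thesis
  proof (rule adjointable_opsI[OF m])
    show "0 \<in> op_bounds (0 :: ('a, 'b) l2_op)" by (simp add: op_bounds_def l2_norm_def ip0)
    show "is_l2_adjoint (0 :: ('a, 'b) l2_op) 0" by (simp add: is_l2_adjoint_def m ip0)
  qed
qed

lemma unitary_delta: "cp_unitary h (delta g) = delta (h + g)"
proof -
  have "- h + k = g \<longleftrightarrow> k = h + g" for k
    by (metis add.assoc add.left_neutral add.right_inverse left_minus)
  then show ?thesis by (simp add: cp_unitary_def delta_def[of g] delta_def[of "h + g"] delta_l2[unfolded delta_def])
qed

lemma cp_unitary_l2_map: "l2_map (cp_unitary h)"
  by (simp add: l2_map_def cp_unitary_def l2_shift)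

lemma cp_unitary_bound: "1 \<in> op_bounds (cp_unitary h)"
  by (simp add: op_bounds_def cp_unitary_def l2_shift)

lemma cp_unitary_adjoint: "is_l2_adjoint (cp_unitary h) (cp_unitary (- h))"
  by (simp add: is_l2_adjoint_def cp_unitary_l2_map) (simp add: cp_unitary_def l2_ip_shift)

lemma cp_unitary_adjointable: "cp_unitary h \<in> adjointable_ops"
  by (rule adjointable_opsI[OF cp_unitary_l2_map cp_unitary_bound cp_unitary_adjoint])

lemma cp_expectation_delta: "cp_expectation x = x (delta 0) 0"
  by (simp add: cp_expectation_def delta_def)

lemma cp_expectation_adj:
  assumes "x \<in> adjointable_ops" "y \<in> adjointable_ops"
  shows "cp_expectation (l2_adj x \<circ> y) = l2_ip (x (delta 0)) (y (delta 0))"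
proof -
  obtain c S where S: "is_l2_adjoint x S" using assms(1) by (auto simp: adjointable_ops_def)
  have "y (delta 0) \<in> l2" using assms(2) by (auto simp: adjointable_ops_def l2_mapD)
  then have "l2_ip (x (delta 0)) (y (delta 0)) = l2_ip (delta 0) (S (y (delta 0)))"
    using S by (simp add: is_l2_adjoint_def)
  then show ?thesis by (simp add: cp_expectation_delta l2_adj_eq[OF S] l2_ip_delta)
qed

locale crossed_product =
  fixes \<alpha> :: "'g::group_add \<Rightarrow> 'a::unital_cstar_algebra \<Rightarrow> 'a"
  assumes action: "cstar_action \<alpha>"
begin

abbreviation B where "B \<equiv> reduced_crossed_product \<alpha>"
abbreviation monomial where "monomial g a \<equiv> cp_embed \<alpha> a \<circ> cp_unitary g"

lemmas act_simps = cstar_action_hom(1-5)[OF action] cstar_action_hom_zero[OF action]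
  cstar_action_zero[OF action] cstar_action_add[OF action] cstar_action_minus[OF action]

lemma cp_embed_l2:
  assumes "\<xi> \<in> l2"
  shows "(\<lambda>g. \<alpha> (- g) a * \<xi> g) \<in> l2" "l2_norm (\<lambda>g. \<alpha> (- g) a * \<xi> g) \<le> norm a * l2_norm \<xi>"
  by (rule l2_left_mult[OF assms], rule cstar_action_hom(6)[OF action])+

lemma cp_embed_l2_map: "l2_map (cp_embed \<alpha> a)"
  by (simp add: l2_map_def cp_embed_def cp_embed_l2)

lemma cp_embed_bound: "norm a \<in> op_bounds (cp_embed \<alpha> a)"
  by (simp add: op_bounds_def cp_embed_def cp_embed_l2)

lemma cp_embed_adjoint: "is_l2_adjoint (cp_embed \<alpha> a) (cp_embed \<alpha> (star a))"
  by (simp add: is_l2_adjoint_def cp_embed_l2_map)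
     (simp add: cp_embed_def l2_ip_left_mult act_simps)

lemma cp_embed_adjointable: "cp_embed \<alpha> a \<in> adjointable_ops"
  by (rule adjointable_opsI[OF cp_embed_l2_map cp_embed_bound cp_embed_adjoint])

lemma monomial_adjointable: "monomial g a \<in> adjointable_ops"
  by (intro adjointable_ops_comp cp_embed_adjointable cp_unitary_adjointable)

lemma cp_embed_one: "monomial g 1 = cp_unitary g"
proof (rule ext)
  fix \<xi> :: "'g \<Rightarrow> 'a"
  have "cp_unitary g \<xi> \<in> l2" by (rule l2_mapD[OF cp_unitary_l2_map])
  then show "monomial g 1 \<xi> = cp_unitary g \<xi>" by (simp add: cp_embed_def act_simps)
qed

lemma monomial_apply: "\<xi> \<in> l2 \<Longrightarrow> monomial g a \<xi> k = \<alpha> (- k) a * \<xi> (- g + k)"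
  by (simp add: cp_embed_def cp_unitary_def l2_shift)

lemma monomial_outside: "\<xi> \<notin> l2 \<Longrightarrow> monomial g a \<xi> = 0"
  by (simp add: cp_unitary_def) (simp add: cp_embed_def fun_eq_iff)

lemma op_eqI:
  assumes "\<And>\<xi> k. \<xi> \<in> l2 \<Longrightarrow> T \<xi> k = S \<xi> k" "\<And>\<xi>. \<xi> \<notin> l2 \<Longrightarrow> T \<xi> = 0" "\<And>\<xi>. \<xi> \<notin> l2 \<Longrightarrow> S \<xi> = 0"
  shows "T = (S :: ('g, 'a) l2_op)"
proof (rule ext)
  show "T \<xi> = S \<xi>" for \<xi> using assms by (cases "\<xi> \<in> l2") (auto simp: fun_eq_iff)
qed

lemma monomial_add: "monomial g (a + b) = monomial g a + monomial g b"
  by (rule op_eqI) (simp_all add: monomial_apply monomial_outside act_simps distrib_right del: comp_apply)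

lemma monomial_zero: "monomial g 0 = 0"
  by (rule op_eqI) (simp_all add: monomial_apply monomial_outside act_simps del: comp_apply)

lemma monomial_scaleC: "c *\<^sub>C monomial g a = monomial g (c *\<^sub>C a)"
  by (rule op_eqI)
     (simp_all add: monomial_apply monomial_outside act_simps scaleC_mult_left scaleC_fun_def fun_eq_iff del: comp_apply)

lemma monomial_l2_map: "l2_map (monomial g a)"
  using monomial_adjointable[where g = g and a = a] by (rule adjointable_opsE)

lemma monomial_at_zero: "monomial g a 0 = 0"
  using monomial_adjointable[where g = g and a = a] by (rule adjointable_opsE) (rule l2_adjoint_zero(1))

lemma cp_embed_monomial: "cp_embed \<alpha> b \<circ> monomial g a = monomial g (b * a)"
proof (rule op_eqI)
  fix \<xi> :: "'g \<Rightarrow> 'a" and k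
  assume \<xi>: "\<xi> \<in> l2"
  have "monomial g a \<xi> \<in> l2" by (rule l2_mapD[OF monomial_l2_map])
  then have "(cp_embed \<alpha> b \<circ> monomial g a) \<xi> k = \<alpha> (- k) b * monomial g a \<xi> k"
    by (simp add: cp_embed_def[of \<alpha> b])
  also have "\<dots> = monomial g (b * a) \<xi> k"
    unfolding monomial_apply[OF \<xi>] by (simp add: act_simps mult.assoc)
  finally show "(cp_embed \<alpha> b \<circ> monomial g a) \<xi> k = monomial g (b * a) \<xi> k" .
next
  fix \<xi> :: "'g \<Rightarrow> 'a"
  assume \<xi>: "\<xi> \<notin> l2"
  then show "monomial g (b * a) \<xi> = 0" by (rule monomial_outside)
  have "(cp_embed \<alpha> b \<circ> monomial g a) \<xi> = cp_embed \<alpha> b 0" using monomial_outside[OF \<xi>, where g = g and a = a] by simp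
  then show "(cp_embed \<alpha> b \<circ> monomial g a) \<xi> = 0" by (simp add: cp_embed_def fun_eq_iff)
qed

lemma monomial_cp_embed: "monomial g a \<circ> cp_embed \<alpha> b = monomial g (a * \<alpha> g b)"
proof (rule op_eqI)
  fix \<xi> :: "'g \<Rightarrow> 'a" and k
  assume \<xi>: "\<xi> \<in> l2"
  have l: "cp_embed \<alpha> b \<xi> \<in> l2" by (rule l2_mapD[OF cp_embed_l2_map])
  have "(monomial g a \<circ> cp_embed \<alpha> b) \<xi> k = \<alpha> (- k) a * cp_embed \<alpha> b \<xi> (- g + k)"
    using monomial_apply[OF l] by simp
  also have "\<dots> = \<alpha> (- k) a * (\<alpha> (- k + g) b * \<xi> (- g + k))"
    using \<xi> by (simp add: cp_embed_def minus_add)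
  also have "\<dots> = monomial g (a * \<alpha> g b) \<xi> k"
    using monomial_apply[OF \<xi>, where g = g and a = "a * \<alpha> g b" and k = k] by (simp add: act_simps mult.assoc)
  finally show "(monomial g a \<circ> cp_embed \<alpha> b) \<xi> k = monomial g (a * \<alpha> g b) \<xi> k" .
next
  fix \<xi> :: "'g \<Rightarrow> 'a"
  assume \<xi>: "\<xi> \<notin> l2"
  show "monomial g (a * \<alpha> g b) \<xi> = 0" using \<xi> by (rule monomial_outside)
  show "(monomial g a \<circ> cp_embed \<alpha> b) \<xi> = 0"
    using \<xi> monomial_at_zero[where g = g and a = a] by (simp add: cp_embed_def[of \<alpha> b])
qed

lemma alg_eq: "algebraic_crossed_product \<alpha> = {x. \<exists>F a. finite F \<and> x = (\<Sum>g\<in>F. monomial g (a g))}"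
  by (simp add: algebraic_crossed_product_def)

lemma alg_monomial: "monomial g a \<in> algebraic_crossed_product \<alpha>"
  unfolding alg_eq by (intro CollectI exI[of _ "{g}"] exI[of _ "\<lambda>_. a"]) simp

lemma alg_zero: "0 \<in> algebraic_crossed_product \<alpha>"
  unfolding alg_eq by (intro CollectI exI[of _ "{}"]) simp

lemma alg_add:
  assumes "x \<in> algebraic_crossed_product \<alpha>" "y \<in> algebraic_crossed_product \<alpha>"
  shows "x + y \<in> algebraic_crossed_product \<alpha>"
proof -
  have ext: "(\<Sum>g\<in>F. monomial g (a g)) = (\<Sum>g\<in>F \<union> G. monomial g (if g \<in> F then a g else 0))"
    if "finite F" "finite G" for F G :: "'g set" and a
  proof -
    have "(\<Sum>g\<in>F \<union> G. monomial g (if g \<in> F then a g else 0)) = (\<Sum>g\<in>F. monomial g (if g \<in> F then a g else 0))"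
      by (rule sum.mono_neutral_right) (use that monomial_zero in auto)
    also have "\<dots> = (\<Sum>g\<in>F. monomial g (a g))" by (rule sum.cong) auto
    finally show ?thesis ..
  qed
  obtain F a where x: "finite F" "x = (\<Sum>g\<in>F. monomial g (a g))" using assms(1) by (auto simp: alg_eq)
  obtain G b where y: "finite G" "y = (\<Sum>g\<in>G. monomial g (b g))" using assms(2) by (auto simp: alg_eq)
  have eq: "x + y = (\<Sum>g\<in>F \<union> G. monomial g ((if g \<in> F then a g else 0) + (if g \<in> G then b g else 0)))"
    unfolding x(2) y(2) ext[OF x(1) y(1)] ext[OF y(1) x(1)] monomial_add sum.distrib by (simp add: Un_commute)
  show ?thesis
    unfolding alg_eq using x(1) y(1)
    by (intro CollectI exI[of _ "F \<union> G"] conjI exI[of _ "\<lambda>g. (if g \<in> F then a g else 0) + (if g \<in> G then b g else 0)"])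
       (rule finite_UnI eq, assumption+, rule eq)
qed

lemma alg_induct [consumes 1, case_names zero add]:
  assumes x: "x \<in> algebraic_crossed_product \<alpha>" and z: "P 0"
    and s: "\<And>g a y. y \<in> algebraic_crossed_product \<alpha> \<Longrightarrow> P y \<Longrightarrow> P (monomial g a + y)"
  shows "P x"
proof -
  obtain F a where F: "finite F" "x = (\<Sum>g\<in>F. monomial g (a g))" using x by (auto simp: alg_eq)
  have "(\<Sum>g\<in>F. monomial g (a g)) \<in> algebraic_crossed_product \<alpha> \<and> P (\<Sum>g\<in>F. monomial g (a g))"
    using F(1)
  proof (induction F rule: finite_induct)
    case (insert g F)
    then show ?case
      unfolding sum.insert[OF insert(1,2)] using alg_add[OF alg_monomial] s by blast
  next
    case empty
    show ?case unfolding sum.empty using alg_zero z by blast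
  qed
  then show ?thesis using F(2) by simp
qed

lemma alg_adjointable: "x \<in> algebraic_crossed_product \<alpha> \<Longrightarrow> x \<in> adjointable_ops"
  by (induction rule: alg_induct) (rule zero_adjointable, rule adjointable_ops_add[OF monomial_adjointable])

lemma alg_scaleC: "x \<in> algebraic_crossed_product \<alpha> \<Longrightarrow> c *\<^sub>C x \<in> algebraic_crossed_product \<alpha>"
proof (induction rule: alg_induct)
  case zero
  have "c *\<^sub>C (0 :: ('g, 'a) l2_op) = 0" by (simp add: scaleC_fun_def fun_eq_iff)
  then show ?case by (simp only: alg_zero)
next
  case (add g a y)
  have "c *\<^sub>C (monomial g a + y) = c *\<^sub>C monomial g a + c *\<^sub>C y"
    by (simp add: scaleC_fun_def fun_eq_iff scaleC_add_right)
  then show ?case using add alg_add alg_monomial monomial_scaleC by metis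
qed

lemma cp_embed_comp_add:
  assumes "l2_map x" "l2_map y"
  shows "cp_embed \<alpha> a \<circ> (x + y) = (cp_embed \<alpha> a \<circ> x) + (cp_embed \<alpha> a \<circ> y)"
  using assms by (auto simp: fun_eq_iff cp_embed_def l2_mapD l2_add distrib_left)

lemma cp_embed_comp_diff:
  assumes "l2_map x" "l2_map y"
  shows "cp_embed \<alpha> a \<circ> (x - y) = (cp_embed \<alpha> a \<circ> x) - (cp_embed \<alpha> a \<circ> y)"
  using assms l2_map_diff[OF assms] l2_mapD[of "x - y"]
  by (auto simp: fun_eq_iff cp_embed_def l2_mapD right_diff_distrib)

lemma alg_cp_embed_left:
  "x \<in> algebraic_crossed_product \<alpha> \<Longrightarrow> cp_embed \<alpha> b \<circ> x \<in> algebraic_crossed_product \<alpha>"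
proof (induction rule: alg_induct)
  case zero
  have "cp_embed \<alpha> b \<circ> 0 = (0 :: ('g, 'a) l2_op)" by (simp add: cp_embed_def fun_eq_iff)
  then show ?case by (simp only: alg_zero)
next
  case (add g a y)
  have "l2_map (monomial g a)" "l2_map y"
    using monomial_l2_map alg_adjointable[OF add(1)] by (auto simp: adjointable_ops_def)
  then have "cp_embed \<alpha> b \<circ> (monomial g a + y) = monomial g (b * a) + (cp_embed \<alpha> b \<circ> y)"
    by (simp only: cp_embed_comp_add cp_embed_monomial)
  then show ?case using add alg_add alg_monomial by metis
qed

lemma alg_cp_embed_right:
  "x \<in> algebraic_crossed_product \<alpha> \<Longrightarrow> x \<circ> cp_embed \<alpha> b \<in> algebraic_crossed_product \<alpha>"
proof (induction rule: alg_induct)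
  case zero
  have "0 \<circ> cp_embed \<alpha> b = (0 :: ('g, 'a) l2_op)" by (simp add: fun_eq_iff)
  then show ?case by (simp only: alg_zero)
next
  case (add g a y)
  have "(monomial g a + y) \<circ> cp_embed \<alpha> b = monomial g (a * \<alpha> g b) + (y \<circ> cp_embed \<alpha> b)"
    unfolding monomial_cp_embed[symmetric] by (simp add: fun_eq_iff)
  then show ?case using add alg_add alg_monomial by metis
qed

lemma B_adjointable: "x \<in> B \<Longrightarrow> x \<in> adjointable_ops"
  by (simp add: reduced_crossed_product_def)

lemma B_l2_map: "x \<in> B \<Longrightarrow> l2_map x"
  using B_adjointable by (auto simp: adjointable_ops_def)

lemma op_norm_diff_less_iff:
  assumes "x \<in> adjointable_ops" "y \<in> adjointable_ops"
  shows "op_norm (x - y) < e \<longleftrightarrow> (\<exists>c\<in>op_bounds (x - y). c < e)"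
  using adjointable_ops_diff[OF assms] by (intro op_norm_less_iff) (auto simp: adjointable_ops_def)

lemma B_approx:
  assumes "x \<in> B" "e > 0"
  obtains y c where "y \<in> algebraic_crossed_product \<alpha>" "c \<in> op_bounds (x - y)" "c < e"
proof -
  obtain y where y: "y \<in> algebraic_crossed_product \<alpha>" "op_norm (x - y) < e"
    using assms by (auto simp: reduced_crossed_product_def)
  then show ?thesis
    using that op_norm_diff_less_iff[OF B_adjointable[OF assms(1)] alg_adjointable[OF y(1)]] by blast
qed

lemma B_I:
  assumes x: "x \<in> adjointable_ops"
    and ap: "\<And>e. e > 0 \<Longrightarrow> \<exists>y\<in>algebraic_crossed_product \<alpha>. \<exists>c\<in>op_bounds (x - y). c < e"
  shows "x \<in> B"
  unfolding reduced_crossed_product_def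
proof (intro CollectI conjI x allI impI)
  fix e :: real assume "e > 0"
  then obtain y c where "y \<in> algebraic_crossed_product \<alpha>" "c \<in> op_bounds (x - y)" "c < e"
    using ap by blast
  then show "\<exists>y\<in>algebraic_crossed_product \<alpha>. op_norm (x - y) < e"
    using op_norm_diff_less_iff[OF x alg_adjointable] by blast
qed

lemma alg_subset_B: 
  assumes "x \<in> algebraic_crossed_product \<alpha>"
  shows "x \<in> B"
proof (rule B_I[OF alg_adjointable[OF assms]])
  fix e :: real assume "e > 0"
  moreover have "0 \<in> op_bounds (x - x)" by (simp add: op_bounds_def l2_norm_def l2_ip_def)
  ultimately show "\<exists>y\<in>algebraic_crossed_product \<alpha>. \<exists>c\<in>op_bounds (x - y). c < e" using assms by blast
qed

lemma B_add:
  assumes x: "x \<in> B" and y: "y \<in> B"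
  shows "x + y \<in> B"
proof (rule B_I)
  show "x + y \<in> adjointable_ops" by (intro adjointable_ops_add B_adjointable assms)
  fix e :: real assume e: "e > 0"
  \<comment> \<open>The bound for a sum is twice the sum of the bounds, hence the quarters.\<close>
  obtain x' c where x': "x' \<in> algebraic_crossed_product \<alpha>" "c \<in> op_bounds (x - x')" "c < e / 4"
    using B_approx[OF x, of "e / 4"] e by auto
  obtain y' d where y': "y' \<in> algebraic_crossed_product \<alpha>" "d \<in> op_bounds (y - y')" "d < e / 4"
    using B_approx[OF y, of "e / 4"] e by auto
  have "l2_map (x - x')" "l2_map (y - y')"
    by (intro l2_map_diff B_l2_map assms alg_subset_B x'(1) y'(1))+
  then have "2 * (c + d) \<in> op_bounds ((x - x') + (y - y'))" using x' y' by (intro op_bounds_add)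
  moreover have "(x - x') + (y - y') = (x + y) - (x' + y')" by simp
  ultimately have "2 * (c + d) \<in> op_bounds ((x + y) - (x' + y'))" by (simp only:)
  moreover have "2 * (c + d) < e" using x' y' by simp
  ultimately show "\<exists>z\<in>algebraic_crossed_product \<alpha>. \<exists>c\<in>op_bounds (x + y - z). c < e"
    using alg_add[OF x'(1) y'(1)] by blast
qed

text \<open>The reduced crossed product is stable under any operation that preserves the algebraic crossed
  product and multiplies bounds of differences by at most a constant.\<close>

lemma B_transform:
  assumes x: "x \<in> B" and K: "0 \<le> K" and adj: "f x \<in> adjointable_ops"
    and alg: "\<And>y. y \<in> algebraic_crossed_product \<alpha> \<Longrightarrow> f y \<in> algebraic_crossed_product \<alpha>"
    and bound: "\<And>y c. y \<in> algebraic_crossed_product \<alpha> \<Longrightarrow> c \<in> op_bounds (x - y) \<Longrightarrow>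
        K * c \<in> op_bounds (f x - f y)"
  shows "f x \<in> B"
proof (rule B_I[OF adj])
  fix e :: real assume e: "e > 0"
  obtain y c where y: "y \<in> algebraic_crossed_product \<alpha>" "c \<in> op_bounds (x - y)" "c < e / (K + 1)"
    using B_approx[OF x, of "e / (K + 1)"] e K by auto
  have c: "0 \<le> c" using y(2) by (simp add: op_bounds_def)
  have "K * c \<le> (K + 1) * c" using c by (simp add: algebra_simps)
  also have "\<dots> < e" using y(3) K by (simp add: field_simps)
  finally show "\<exists>z\<in>algebraic_crossed_product \<alpha>. \<exists>c\<in>op_bounds (f x - z). c < e"
    using alg[OF y(1)] bound[OF y(1,2)] by blast
qed

lemma B_scaleC:
  assumes x: "x \<in> B"
  shows "c *\<^sub>C x \<in> B"
proof (rule B_transform[OF x norm_ge_zero])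
  show "c *\<^sub>C x \<in> adjointable_ops" by (intro adjointable_ops_scaleC B_adjointable x)
  show "cmod c * d \<in> op_bounds (c *\<^sub>C x - c *\<^sub>C y)"
    if "y \<in> algebraic_crossed_product \<alpha>" "d \<in> op_bounds (x - y)" for y d
  proof -
    have "c *\<^sub>C x - c *\<^sub>C y = c *\<^sub>C (x - y)" by (simp add: scaleC_fun_def fun_eq_iff scaleC_diff_right)
    then show ?thesis
      using that op_bounds_scaleC l2_map_diff B_l2_map[OF x] B_l2_map[OF alg_subset_B] by metis
  qed
qed (rule alg_scaleC)

lemma B_diff: "x \<in> B \<Longrightarrow> y \<in> B \<Longrightarrow> x - y \<in> B"
  unfolding op_diff_eq by (intro B_add B_scaleC)

lemma B_cp_embed_left:
  assumes x: "x \<in> B"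
  shows "cp_embed \<alpha> a \<circ> x \<in> B"
proof (rule B_transform[where f = "\<lambda>x. cp_embed \<alpha> a \<circ> x", OF x norm_ge_zero])
  show "cp_embed \<alpha> a \<circ> x \<in> adjointable_ops"
    by (intro adjointable_ops_comp cp_embed_adjointable B_adjointable x)
  show "norm a * d \<in> op_bounds ((cp_embed \<alpha> a \<circ> x) - (cp_embed \<alpha> a \<circ> y))"
    if y: "y \<in> algebraic_crossed_product \<alpha>" and d: "d \<in> op_bounds (x - y)" for y d
    using op_bounds_comp[OF cp_embed_bound d l2_map_diff] B_l2_map[OF x] B_l2_map[OF alg_subset_B[OF y]]
    by (simp add: cp_embed_comp_diff)
qed (rule alg_cp_embed_left)

lemma B_cp_embed_right:
  assumes x: "x \<in> B"
  shows "x \<circ> cp_embed \<alpha> a \<in> B"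
proof (rule B_transform[where f = "\<lambda>x. x \<circ> cp_embed \<alpha> a", OF x norm_ge_zero])
  show "x \<circ> cp_embed \<alpha> a \<in> adjointable_ops"
    by (intro adjointable_ops_comp cp_embed_adjointable B_adjointable x)
  show "norm a * d \<in> op_bounds ((x \<circ> cp_embed \<alpha> a) - (y \<circ> cp_embed \<alpha> a))"
    if y: "y \<in> algebraic_crossed_product \<alpha>" and d: "d \<in> op_bounds (x - y)" for y d
  proof -
    have "(x \<circ> cp_embed \<alpha> a) - (y \<circ> cp_embed \<alpha> a) = (x - y) \<circ> cp_embed \<alpha> a" by (simp add: fun_eq_iff)
    then show ?thesis using op_bounds_comp[OF d cp_embed_bound cp_embed_l2_map] by (simp add: mult.commute)
  qed
qed (rule alg_cp_embed_right)

lemma unitary_B: "cp_unitary g \<in> B"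
  using alg_subset_B[OF alg_monomial[where g = g and a = 1]] by (simp only: cp_embed_one)

lemma op_bound_delta:
  fixes x :: "('g, 'a) l2_op"
  assumes "l2_map x" "c \<in> op_bounds x"
  shows "norm (x (delta g) k) \<le> c"
proof -
  have "norm (x (delta g) k) \<le> l2_norm (x (delta g))"
    by (rule norm_coordinate_le_l2_norm[OF l2_mapD[OF assms(1)]])
  also have "\<dots> \<le> c * l2_norm (delta g :: 'g \<Rightarrow> 'a)" using assms(2) by (simp add: op_bounds_def)
  finally show ?thesis by (simp add: l2_norm_delta)
qed

text \<open>The left side is \<open>E (x u\<^sub>g\<^sup>-\<^sup>1)\<close>, which defines the support of \<open>x\<close>; the value of \<open>x \<delta>\<^sub>e\<close> at \<open>g\<close> on the right
  is \<open>E (u\<^sub>g\<^sup>* x)\<close>, which is the coordinate of \<open>x\<close> in the completion. The two are compared on monomials and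
  depend continuously on \<open>x\<close>.\<close>

lemma fourier_coefficient:
  assumes x: "x \<in> B"
  shows "x (delta (- g)) 0 = \<alpha> g (x (delta 0) g)"
proof -
  have alg: "y (delta (- g)) 0 = \<alpha> g (y (delta 0) g)" if "y \<in> algebraic_crossed_product \<alpha>" for y
    using that
  proof (induction rule: alg_induct)
    case (add h a y)
    have "monomial h a (delta (- g)) 0 = \<alpha> g (monomial h a (delta 0) g)"
    proof -
      have "- h = - g \<longleftrightarrow> - h + g = 0" by (metis add.left_inverse add_diff_cancel diff_conv_add_uminus neg_equal_iff_equal eq_neg_iff_add_eq_0)
      then show ?thesis
        by (simp only: monomial_apply[OF delta_l2]) (simp add: delta_def act_simps)
    qed
    then show ?case using add by (simp add: act_simps del: comp_apply)
  qed (simp add: act_simps)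
  have "norm (x (delta (- g)) 0 - \<alpha> g (x (delta 0) g)) \<le> e" if e: "e > 0" for e
  proof -
    obtain y c where y: "y \<in> algebraic_crossed_product \<alpha>" "c \<in> op_bounds (x - y)" "c < e / 2"
      using B_approx[OF x, of "e / 2"] e by auto
    have m: "l2_map (x - y)" by (intro l2_map_diff B_l2_map x alg_subset_B y)
    have "x (delta (- g)) 0 - \<alpha> g (x (delta 0) g) = (x - y) (delta (- g)) 0 - \<alpha> g ((x - y) (delta 0) g)"
    proof -
      have "\<alpha> g (x (delta 0) g) = \<alpha> g ((x - y) (delta 0) g) + \<alpha> g (y (delta 0) g)"
        by (simp flip: act_simps(1))
      then show ?thesis using alg[OF y(1)] by simp
    qed
    also have "norm \<dots> \<le> norm ((x - y) (delta (- g)) 0) + norm (\<alpha> g ((x - y) (delta 0) g))"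
      by (rule norm_triangle_ineq4)
    also have "\<dots> \<le> c + c"
      using op_bound_delta[OF m y(2)] cstar_action_hom(6)[OF action] by (meson add_mono order_trans)
    finally show ?thesis using y(3) by simp
  qed
  then have "norm (x (delta (- g)) 0 - \<alpha> g (x (delta 0) g)) \<le> 0" by (rule field_le_epsilon) simp
  then show ?thesis by simp
qed

lemma cp_supp_eq:
  assumes "x \<in> B"
  shows "cp_supp x = {g. x (delta 0) g \<noteq> 0}"
proof -
  have "\<alpha> g a = 0 \<longleftrightarrow> a = 0" for g a
    by (metis act_simps(6) cstar_action_minus(2)[OF action])
  then show ?thesis
    by (simp add: cp_supp_def cp_expectation_delta unitary_delta fourier_coefficient[OF assms])
qed

end

section \<open>Hilbert modules\<close>

context right_hilbert_module
begin

lemma ip_add_left: "ip (x + y) z = ip x z + ip y z"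
  by (metis ip_add_right star_add star_ip)

lemma ip_scaleC_left: "ip (c *\<^sub>C x) y = cnj c *\<^sub>C ip x y"
  by (metis ip_scaleC_right star_scaleC star_ip)

lemma ip_rmul_left: "ip (rmul x a) y = star a * ip x y"
  by (metis ip_rmul_right star_mult star_ip)

lemma ip_zero [simp]: "ip x 0 = 0" "ip 0 x = 0"
  using ip_scaleC_right[of x 0 0] ip_scaleC_left[of 0 0 x] by simp_all

lemma ip_minus_right: "ip x (- y) = - ip x y"
  using ip_scaleC_right[of x "- 1" y] by simp

lemma ip_minus_left: "ip (- x) y = - ip x y"
  using ip_scaleC_left[of "- 1" x y] by simp

lemma ip_diff_right: "ip x (y - z) = ip x y - ip x z"
  using ip_add_right[of x y "- z"] by (simp add: ip_minus_right)

lemma ip_diff_left: "ip (x - y) z = ip x z - ip y z"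
  using ip_add_left[of x "- y" z] by (simp add: ip_minus_left)

lemma ip_scaleR_right: "ip x (r *\<^sub>R y) = r *\<^sub>R ip x y"
  by (simp add: scaleR_scaleC ip_scaleC_right)

lemma ip_scaleR_left: "ip (r *\<^sub>R x) y = r *\<^sub>R ip x y"
  by (simp add: scaleR_scaleC ip_scaleC_left)

lemma positive_ip_self: "positive (ip x x)"
  using ip_positive[of x] positive_star_mult_self by fastforce

lemma norm_square_ip: "(norm x)\<^sup>2 = norm (ip x x)"
  by (subst norm_ip) simp

lemma ip_self_eq_0: "ip x x = 0 \<Longrightarrow> x = 0"
  using norm_square_ip[of x] by simp

lemma ip_orthogonal_swap: "ip x y = 0 \<Longrightarrow> ip y x = 0"
  using star_ip[of x y] by simp

lemma norm_le_of_orthogonal: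
  assumes "ip x y = 0"
  shows "norm x \<le> norm (x + y)"
proof -
  have "ip (x + y) (x + y) = ip x x + ip y y"
    using assms ip_orthogonal_swap[OF assms] by (simp add: ip_add_left ip_add_right)
  then have "norm (ip x x) \<le> norm (ip (x + y) (x + y))"
    using positive_norm_mono[OF positive_ip_self positive_ip_self] by simp
  then have "(norm x)\<^sup>2 \<le> (norm (x + y))\<^sup>2" by (simp add: norm_square_ip)
  then show ?thesis by (rule power2_le_imp_le) simp
qed

text \<open>With \<open>a = \<langle>x | y\<rangle>\<close> the inequality \<open>a\<^sup>* a \<le> \<parallel>x\<parallel>\<^sup>2 \<langle>y | y\<rangle>\<close> follows from the positivity of \<open>\<langle>w | w\<rangle>\<close> for
  \<open>w = \<parallel>x\<parallel> y - \<parallel>x\<parallel>\<^sup>-\<^sup>1 x a\<close> and from \<open>\<langle>x | x\<rangle> \<le> \<parallel>x\<parallel>\<^sup>2\<close>.\<close>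

lemma Cauchy_Schwarz: "norm (ip x y) \<le> norm x * norm y"
proof (cases "x = 0")
  case False
  define N where "N = norm x"
  define a where "a = ip x y"
  have N: "N > 0" using False by (simp add: N_def)
  define w where "w = N *\<^sub>R y - (1 / N) *\<^sub>R rmul x a"
  have yx: "ip y x = star a" by (simp add: a_def star_ip)
  have ww: "ip w w = (N * N) *\<^sub>R ip y y - star a * a - star a * a + (1 / (N * N)) *\<^sub>R (star a * ip x x * a)"
    unfolding w_def ip_diff_left ip_diff_right ip_scaleR_left ip_scaleR_right ip_rmul_left ip_rmul_right
      yx a_def[symmetric]
    using N by (simp add: mult.assoc scaleR_diff_right left_diff_distrib)
  have "positive (of_real (N * N) - ip x x)"
    using norm_square_ip[of x] by (intro positive_of_real_diff) (simp_all add: star_ip N_def power2_eq_square)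
  then have "positive (star a * (of_real (N * N) - ip x x) * a)" by (rule positive_conjugate)
  then have "positive ((1 / (N * N)) *\<^sub>R (star a * (of_real (N * N) - ip x x) * a))"
    by (rule positive_scaleR) simp
  also have "(1 / (N * N)) *\<^sub>R (star a * (of_real (N * N) - ip x x) * a)
      = star a * a - (1 / (N * N)) *\<^sub>R (star a * ip x x * a)"
  proof -
    have "star a * (of_real (N * N) - ip x x) * a = (N * N) *\<^sub>R (star a * a) - star a * ip x x * a"
      by (simp add: of_real_def right_diff_distrib left_diff_distrib)
    then show ?thesis using N by (simp add: scaleR_diff_right)
  qed
  finally have "positive (star a * a - (1 / (N * N)) *\<^sub>R (star a * ip x x * a) + ip w w)"
    using positive_ip_self by (rule positive_add)
  then have "positive ((N * N) *\<^sub>R ip y y - star a * a)" by (simp add: ww)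
  then have "norm (star a * a) \<le> norm ((N * N) *\<^sub>R ip y y)"
    by (rule positive_norm_diff_mono[OF positive_star_mult_self])
  then have "(norm a)\<^sup>2 \<le> (N * norm y)\<^sup>2"
    by (simp add: cstar_identity power_mult_distrib norm_square_ip power2_eq_square[of N])
  then have "norm a \<le> N * norm y" by (rule power2_le_imp_le) (simp add: N_def)
  then show ?thesis by (simp add: a_def N_def)
qed simp

lemma ip_tendsto:
  assumes "(f \<longlongrightarrow> x) F"
  shows "((\<lambda>n. ip y (f n)) \<longlongrightarrow> ip y x) F"
proof (rule LIM_zero_cancel, rule tendsto_norm_zero_cancel)
  have z: "((\<lambda>n. norm y * norm (f n - x)) \<longlongrightarrow> 0) F"
    using tendsto_mult_right_zero[OF tendsto_norm_zero[OF LIM_zero[OF assms]], of "norm y"] by simp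
  show "((\<lambda>n. norm (ip y (f n) - ip y x)) \<longlongrightarrow> 0) F"
    by (rule tendsto_0_le[OF z, of _ 1])
       (use Cauchy_Schwarz[of y] in \<open>auto simp flip: ip_diff_right\<close>)
qed

end

context right_correspondence
begin

lemma lmul_adjoint': "ip x (lmul a y) = ip (lmul (star a) x) y"
  by (simp add: lmul_adjoint star_star)

text \<open>Additivity in the module variable is a consequence of adjointability.\<close>

lemma lmul_add_right: "lmul a (x + y) = lmul a x + lmul a y"
proof -
  define d where "d = lmul a (x + y) - (lmul a x + lmul a y)"
  have "ip w d = 0" for w
    by (simp add: d_def ip_diff_right ip_add_right lmul_adjoint')
  then show ?thesis using ip_self_eq_0[of d] by (simp add: d_def)
qed

end

section \<open>Fourier coefficients in the completion\<close>

locale completed_crossed_product = crossed_product \<alpha> + crossed_product_completion rmul ip lmul \<alpha> \<Lambda>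
  for rmul :: "'h::complex_banach \<Rightarrow> 'a::unital_cstar_algebra \<Rightarrow> 'h" and ip and lmul
    and \<alpha> :: "'g::group_add \<Rightarrow> 'a \<Rightarrow> 'a" and \<Lambda>
begin

definition v :: "'g \<Rightarrow> 'h" where "v g = \<Lambda> (cp_unitary g)"

lemma ip_v:
  assumes "x \<in> B"
  shows "ip (v g) (\<Lambda> x) = x (delta 0) g"
  using assms unfolding v_def
  by (simp add: \<Lambda>_ip unitary_B cp_expectation_adj cp_unitary_adjointable B_adjointable unitary_delta l2_ip_delta)

lemma ip_v_v: "ip (v g) (v h) = (if g = h then 1 else 0)"
  unfolding v_def[of h] ip_v[OF unitary_B] unitary_delta by (simp add: delta_def)

lemma \<Lambda>_monomial: "\<Lambda> (monomial g a) = lmul a (v g)" "\<Lambda> (monomial g (\<alpha> g a)) = rmul (v g) a"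
proof -
  show "\<Lambda> (monomial g a) = lmul a (v g)" unfolding v_def by (rule \<Lambda>_left[OF unitary_B])
  have "cp_unitary g \<circ> cp_embed \<alpha> a = monomial g (\<alpha> g a)"
    using monomial_cp_embed[where g = g and a = 1 and b = a] by (simp only: cp_embed_one mult_1)
  then show "\<Lambda> (monomial g (\<alpha> g a)) = rmul (v g) a" 
    unfolding v_def using \<Lambda>_right[OF unitary_B] by metis
qed

lemma lmul_v: "lmul a (v g) = rmul (v g) (\<alpha> (- g) a)"
  using \<Lambda>_monomial[where g = g and a = "\<alpha> (- g) a"] \<Lambda>_monomial(1)[where g = g and a = a]
  by (simp only: act_simps)

lemma norm_\<Lambda>_le:
  assumes x: "x \<in> B" and c: "c \<in> op_bounds x"
  shows "norm (\<Lambda> x) \<le> c"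
proof -
  have "(norm (\<Lambda> x))\<^sup>2 = (l2_norm (x (delta 0)))\<^sup>2"
    using x by (simp add: norm_square_ip \<Lambda>_ip cp_expectation_adj B_adjointable l2_norm_square)
  then have "norm (\<Lambda> x) = l2_norm (x (delta 0))"
    by (rule power2_eq_imp_eq) (simp_all add: l2_norm_nonneg)
  also have "\<dots> \<le> c * l2_norm (delta 0 :: 'g \<Rightarrow> 'a)" using c by (simp add: op_bounds_def)
  finally show ?thesis by (simp add: l2_norm_delta)
qed

lemma \<Lambda>_diff:
  assumes "x \<in> B" "y \<in> B"
  shows "\<Lambda> (x - y) = \<Lambda> x - \<Lambda> y"
  unfolding op_diff_eq using assms by (simp add: \<Lambda>_add \<Lambda>_scaleC B_scaleC)

text \<open>Finite sums \<open>v\<^sub>g a\<^sub>g + \<dots>\<close> with \<open>g\<close> in \<open>S\<close> are generated term by term, with repetitions of \<open>g\<close> allowed; the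
  induction principle then splits a sum along a subset of the group.\<close>

inductive_set fin_span :: "'g set \<Rightarrow> 'h set" for S where
  zero: "0 \<in> fin_span S"
| add: "g \<in> S \<Longrightarrow> z \<in> fin_span S \<Longrightarrow> rmul (v g) a + z \<in> fin_span S"

definition supported_on :: "'g set \<Rightarrow> 'h set" where
  "supported_on S = {z. \<forall>g. g \<notin> S \<longrightarrow> ip (v g) z = 0}"

lemma supported_on_subspace:
  "0 \<in> supported_on S" "x \<in> supported_on S \<Longrightarrow> y \<in> supported_on S \<Longrightarrow> x + y \<in> supported_on S"
  "x \<in> supported_on S \<Longrightarrow> y \<in> supported_on S \<Longrightarrow> x - y \<in> supported_on S"
  "x \<in> supported_on S \<Longrightarrow> c *\<^sub>C x \<in> supported_on S"
  by (simp_all add: supported_on_def ip_add_right ip_diff_right ip_scaleC_right)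

lemma ip_v_lmul: "ip (v g) (lmul a z) = \<alpha> (- g) a * ip (v g) z"
  by (simp add: lmul_adjoint' lmul_v ip_rmul_left act_simps star_star)

lemma supported_on_bimodule:
  assumes "x \<in> supported_on S"
  shows "lmul a x \<in> supported_on S" "rmul x a \<in> supported_on S"
  using assms by (simp_all add: supported_on_def ip_v_lmul ip_rmul_right)

lemma closed_supported_on: "closed (supported_on S)"
  unfolding closed_sequential_limits
proof (intro allI impI, elim conjE)
  fix f z assume f: "\<forall>n. f n \<in> supported_on S" and z: "f \<longlonglongrightarrow> z"
  show "z \<in> supported_on S"
    unfolding supported_on_def
  proof (intro CollectI allI impI)
    fix g assume "g \<notin> S"
    then have "ip (v g) (f n) = 0" for n using f by (simp add: supported_on_def)
    then show "ip (v g) z = 0" using ip_tendsto[OF z, of "v g"] by (simp add: LIMSEQ_const_iff)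
  qed
qed

lemma subcorrespondence_supported_on: "subcorrespondence rmul lmul (supported_on S)"
  by (simp add: subcorrespondence_def complex_subspace_def supported_on_subspace
      supported_on_bimodule closed_supported_on)

lemma v_supported_on_iff: "v g \<in> supported_on S \<longleftrightarrow> g \<in> S"
  by (auto simp: supported_on_def ip_v_v)

lemma fin_span_subset:
  assumes L: "subcorrespondence rmul lmul L" and "\<And>g. g \<in> S \<Longrightarrow> v g \<in> L"
  shows "fin_span S \<subseteq> L"
proof
  fix z assume "z \<in> fin_span S"
  then show "z \<in> L"
    using assms by induction (simp_all add: subcorrespondence_def complex_subspace_def)
qed

lemma fin_span_supported_on: "fin_span S \<subseteq> supported_on S"
  by (rule fin_span_subset[OF subcorrespondence_supported_on]) (simp add: v_supported_on_iff)

lemma supported_on_orthogonal_fin_span: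
  assumes "x \<in> supported_on S" "y \<in> fin_span (- S)"
  shows "ip x y = 0"
  using assms(2)
proof induction
  case (add g z a)
  then have "ip (v g) x = 0" using assms(1) by (simp add: supported_on_def)
  then have "ip x (v g) = 0" by (rule ip_orthogonal_swap)
  then show ?case using add by (simp add: ip_add_right ip_rmul_right)
qed simp

lemma fin_span_split:
  assumes "z \<in> fin_span UNIV"
  shows "\<exists>x\<in>fin_span S. \<exists>y\<in>fin_span (- S). z = x + y"
  using assms
proof induction
  case zero
  have "(0::'h) = 0 + 0" by simp
  then show ?case using fin_span.zero by blast
next
  case (add g z a)
  then obtain x y where xy: "x \<in> fin_span S" "y \<in> fin_span (- S)" "z = x + y" by blast
  show ?case
  proof (cases "g \<in> S")
    case True
    then have "rmul (v g) a + x \<in> fin_span S" using xy(1) by (rule fin_span.add)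
    moreover have "rmul (v g) a + z = (rmul (v g) a + x) + y" by (simp add: xy(3))
    ultimately show ?thesis using xy(2) by blast
  next
    case False
    then have "rmul (v g) a + y \<in> fin_span (- S)" using xy(2) by (intro fin_span.add) auto
    moreover have "rmul (v g) a + z = x + (rmul (v g) a + y)" by (simp add: xy(3))
    ultimately show ?thesis using xy(1) by blast
  qed
qed

lemma \<Lambda>_zero: "\<Lambda> 0 = 0"
proof -
  have "(0::('g, 'a) l2_op) \<in> B" by (rule alg_subset_B[OF alg_zero])
  then show ?thesis using \<Lambda>_diff[of 0 0] by simp
qed

lemma \<Lambda>_alg: "x \<in> algebraic_crossed_product \<alpha> \<Longrightarrow> \<Lambda> x \<in> fin_span UNIV"
proof (induction rule: alg_induct)
  case zero
  show ?case unfolding \<Lambda>_zero by (rule fin_span.zero)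
next
  case (add g a y)
  have "\<Lambda> (monomial g a + y) = rmul (v g) (\<alpha> (- g) a) + \<Lambda> y"
    using \<Lambda>_add[OF alg_subset_B[OF alg_monomial] alg_subset_B[OF add(1)]]
    by (simp only: \<Lambda>_monomial(1) lmul_v)
  then show ?case using fin_span.add[OF UNIV_I add(2)] by (simp only:)
qed

lemma fin_span_dense: "e > 0 \<Longrightarrow> \<exists>w\<in>fin_span UNIV. norm (z - w) < e"
proof -
  assume e: "e > 0"
  have "z \<in> closure (\<Lambda> ` B)" by (simp add: \<Lambda>_dense)
  then have "\<exists>y\<in>\<Lambda> ` B. dist y z < e / 2"
    using e unfolding closure_approachable by (metis half_gt_zero)
  then obtain x where x: "x \<in> B" "norm (z - \<Lambda> x) < e / 2"
    by (auto simp: dist_norm norm_minus_commute)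
  obtain y c where y: "y \<in> algebraic_crossed_product \<alpha>" "c \<in> op_bounds (x - y)" "c < e / 2"
    using B_approx[OF x(1), of "e / 2"] e by auto
  have yB: "y \<in> B" using y(1) by (rule alg_subset_B)
  have "norm (\<Lambda> x - \<Lambda> y) < e / 2"
    using norm_\<Lambda>_le[OF B_diff[OF x(1) yB] y(2)] y(3) by (simp add: \<Lambda>_diff[OF x(1) yB])
  then have "norm (z - \<Lambda> y) < e"
    using x(2) norm_triangle_ineq[of "z - \<Lambda> x" "\<Lambda> x - \<Lambda> y"] by simp
  then show ?thesis using \<Lambda>_alg[OF y(1)] by blast
qed

text \<open>If a finite combination \<open>x + y\<close> is close to \<open>z\<close>, with the terms in \<open>S\<close> collected in \<open>x\<close>, then \<open>x\<close> is at
  least as close, because \<open>y\<close> is orthogonal to \<open>z - x\<close>.\<close>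

lemma supported_on_closure: "supported_on S = closure (fin_span S)"
proof
  show "closure (fin_span S) \<subseteq> supported_on S"
    by (rule closure_minimal[OF fin_span_supported_on closed_supported_on])
  show "supported_on S \<subseteq> closure (fin_span S)"
  proof
    fix z assume z: "z \<in> supported_on S"
    show "z \<in> closure (fin_span S)"
      unfolding closure_approachable
    proof (intro allI impI)
      fix e :: real assume "e > 0"
      then obtain w where w: "w \<in> fin_span UNIV" "norm (z - w) < e" using fin_span_dense by blast
      obtain x y where xy: "x \<in> fin_span S" "y \<in> fin_span (- S)" "w = x + y"
        using fin_span_split[OF w(1)] by blast
      have "z - x \<in> supported_on S" using z xy(1) fin_span_supported_on supported_on_subspace(3) by blast
      then have "ip (z - x) (- y) = 0"
        using supported_on_orthogonal_fin_span[OF _ xy(2)] by (simp add: ip_minus_right)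
      then have "norm (z - x) \<le> norm (z - x + - y)" by (rule norm_le_of_orthogonal)
      also have "z - x + - y = z - w" by (simp add: xy(3))
      finally show "\<exists>y\<in>fin_span S. dist y z < e"
        using w(2) xy(1) by (intro bexI[of _ x]) (simp_all add: dist_norm norm_minus_commute)
    qed
  qed
qed

lemma supported_on_orthogonal:
  assumes x: "x \<in> supported_on S" and y: "y \<in> supported_on (- S)"
  shows "ip x y = 0"
proof -
  obtain f where f: "\<And>n. f n \<in> fin_span (- S)" "f \<longlonglongrightarrow> y"
    using y by (auto simp: supported_on_closure closure_sequential)
  have "ip x (f n) = 0" for n by (rule supported_on_orthogonal_fin_span[OF x f(1)])
  then show ?thesis using ip_tendsto[OF f(2), of x] by (simp add: LIMSEQ_const_iff)
qed

text \<open>Finite combinations split, and the truncation to \<open>S\<close> is a contraction on them. So the truncations of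
  a sequence that converges to \<open>z\<close> form a Cauchy sequence.\<close>

lemma supported_on_decomposition: "\<exists>x\<in>supported_on S. \<exists>y\<in>supported_on (- S). z = x + y"
proof -
  have "\<exists>x y. x \<in> supported_on S \<and> y \<in> supported_on (- S) \<and> norm (z - (x + y)) < 1 / Suc n" for n
  proof -
    have "0 < 1 / real (Suc n)" by simp
    then obtain w where w: "w \<in> fin_span UNIV" "norm (z - w) < 1 / Suc n" using fin_span_dense by blast
    obtain x y where xy: "x \<in> fin_span S" "y \<in> fin_span (- S)" "w = x + y"
      using fin_span_split[OF w(1)] by blast
    show ?thesis
      using w(2) xy fin_span_supported_on[of S] fin_span_supported_on[of "- S"]
      by (intro exI[of _ x] exI[of _ y]) auto
  qed
  then obtain f h where fh: "\<And>n. f n \<in> supported_on S" "\<And>n. h n \<in> supported_on (- S)"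
      "\<And>n. norm (z - (f n + h n)) < 1 / Suc n"
    by metis
  have lim: "(\<lambda>n. f n + h n) \<longlonglongrightarrow> z"
  proof (rule LIM_zero_cancel, rule tendsto_norm_zero_cancel)
    show "(\<lambda>n. norm (f n + h n - z)) \<longlonglongrightarrow> 0"
      by (rule tendsto_sandwich[OF _ _ tendsto_const LIMSEQ_inverse_real_of_nat])
         (use fh(3) in \<open>auto simp: norm_minus_commute inverse_eq_divide less_imp_le\<close>)
  qed
  have "norm (f m - f n) \<le> norm ((f m + h m) - (f n + h n))" for m n
  proof -
    have "ip (f m - f n) (h m - h n) = 0"
      by (intro supported_on_orthogonal[of _ S] supported_on_subspace(3) fh)
    from norm_le_of_orthogonal[OF this] show ?thesis by (simp add: algebra_simps)
  qed
  then have "Cauchy f"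
    using LIMSEQ_imp_Cauchy[OF lim] unfolding Cauchy_def dist_norm by (meson le_less_trans)
  then obtain x where x: "f \<longlonglongrightarrow> x" using Cauchy_convergent_iff convergent_def by blast
  have xS: "x \<in> supported_on S" by (rule closed_sequentially[OF closed_supported_on _ x]) (simp add: fh)
  have "(\<lambda>n. (f n + h n) - f n) \<longlonglongrightarrow> z - x" by (intro tendsto_diff lim x)
  then have lim': "h \<longlonglongrightarrow> z - x" by simp
  have "z - x \<in> supported_on (- S)"
    by (rule closed_sequentially[OF closed_supported_on _ lim']) (simp add: fh)
  then show ?thesis using xS by (intro bexI[of _ x] bexI[of _ "z - x"]) simp_all
qed

lemma supported_on_complemented: "supported_on S \<in> complemented_subcorrespondences rmul ip lmul"
proof -
  have "supported_on (- S) \<subseteq> orth_complement ip (supported_on S)"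
    using supported_on_orthogonal[of _ S] by (auto simp: orth_complement_def)
  then have "\<exists>x\<in>supported_on S. \<exists>y\<in>orth_complement ip (supported_on S). z = x + y" for z
    using supported_on_decomposition[of S z] by blast
  then show ?thesis
    using subcorrespondence_supported_on by (simp add: complemented_subcorrespondences_def)
qed

section \<open>Replete bimodules\<close>

definition operators_on :: "'g set \<Rightarrow> ('g, 'a) l2_op set" where
  "operators_on S = {x \<in> B. \<Lambda> x \<in> supported_on S}"

lemma operators_on_supp: "x \<in> operators_on S \<longleftrightarrow> x \<in> B \<and> cp_supp x \<subseteq> S"
  by (auto simp: operators_on_def supported_on_def ip_v cp_supp_eq)

lemma closure_operators_on: "closure (\<Lambda> ` operators_on S) = supported_on S"
proof
  show "closure (\<Lambda> ` operators_on S) \<subseteq> supported_on S"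
    by (rule closure_minimal[OF _ closed_supported_on]) (auto simp: operators_on_def)
  have "z \<in> \<Lambda> ` B" if "z \<in> fin_span S" for z
    using that
  proof induction
    case zero
    show ?case using \<Lambda>_zero alg_subset_B[OF alg_zero] by (metis imageI)
  next
    case (add g z a)
    then obtain x where x: "x \<in> B" "z = \<Lambda> x" by blast
    have m: "monomial g (\<alpha> g a) \<in> B" by (rule alg_subset_B[OF alg_monomial])
    have "rmul (v g) a + z = \<Lambda> (monomial g (\<alpha> g a) + x)"
      unfolding \<Lambda>_add[OF m x(1)] \<Lambda>_monomial(2) x(2) ..
    then show ?case using B_add[OF m x(1)] by (rule image_eqI)
  qed
  then have "fin_span S \<subseteq> \<Lambda> ` operators_on S"
    using fin_span_supported_on by (fastforce simp: operators_on_def)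
  then show "supported_on S \<subseteq> closure (\<Lambda> ` operators_on S)"
    unfolding supported_on_closure by (rule closure_mono)
qed

lemma operators_on_replete_closed: "operators_on S \<in> replete_closed_bimodules \<alpha>"
  unfolding replete_closed_bimodules_def
proof (intro CollectI conjI)
  have z: "(0::('g, 'a) l2_op) \<in> B" by (rule alg_subset_B[OF alg_zero])
  then have "0 \<in> operators_on S" by (simp add: operators_on_def \<Lambda>_zero supported_on_subspace)
  then show "cp_bimodule \<alpha> (operators_on S)"
    unfolding cp_bimodule_def complex_subspace_def
    by (auto simp: operators_on_def \<Lambda>_add \<Lambda>_scaleC \<Lambda>_left \<Lambda>_right supported_on_subspace
        supported_on_bimodule B_add B_scaleC B_cp_embed_left B_cp_embed_right)
  have "cp_supp_set (operators_on S) \<subseteq> S" by (auto simp: cp_supp_set_def operators_on_supp)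
  then show "replete \<alpha> (operators_on S)" by (auto simp: replete_def operators_on_supp)
  show "cp_norm_closed \<alpha> (operators_on S)"
    unfolding cp_norm_closed_def
  proof (intro ballI impI)
    fix y assume y: "y \<in> B" and ap: "\<forall>e>0. \<exists>x\<in>operators_on S. op_norm (y - x) < e"
    have "\<Lambda> y \<in> closure (supported_on S)"
      unfolding closure_approachable
    proof (intro allI impI)
      fix e :: real assume "e > 0"
      then obtain x where x: "x \<in> B" "\<Lambda> x \<in> supported_on S" "op_norm (y - x) < e"
        using ap by (auto simp: operators_on_def)
      then obtain c where c: "c \<in> op_bounds (y - x)" "c < e"
        using op_norm_diff_less_iff[OF B_adjointable[OF y] B_adjointable[OF x(1)]] by auto
      have "norm (\<Lambda> y - \<Lambda> x) < e"
        using norm_\<Lambda>_le[OF B_diff[OF y x(1)] c(1)] c(2) by (simp add: \<Lambda>_diff[OF y x(1)])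
      then show "\<exists>z\<in>supported_on S. dist z (\<Lambda> y) < e"
        using x(2) by (intro bexI[of _ "\<Lambda> x"]) (simp_all add: dist_norm norm_minus_commute)
    qed
    then show "y \<in> operators_on S"
      using y closed_supported_on by (simp add: operators_on_def closure_closed)
  qed
qed

lemma replete_closed_bimodule_eq:
  assumes "X \<in> replete_closed_bimodules \<alpha>"
  shows "X = operators_on (cp_supp_set X)"
  using assms by (auto simp: replete_closed_bimodules_def cp_bimodule_def replete_def
      operators_on_supp cp_supp_set_def)

section \<open>Complemented subcorrespondences\<close>

text \<open>Decompose \<open>v\<^sub>g = x + y\<close> along \<open>L\<close>. By uniqueness of the decomposition \<open>x\<close> inherits the relation
  \<open>a x = x \<alpha>\<^bsub>- g\<^esub>(a)\<close>, so its coordinates at \<open>h \<noteq> g\<close> are intertwiners and vanish, and its coordinate at \<open>g\<close> is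
  central and equal to \<open>\<langle>x | x\<rangle>\<close>, hence a real scalar \<open>r\<close>. Thus \<open>x = r v\<^sub>g\<close>; if \<open>r = 0\<close>, then \<open>v\<^sub>g = y\<close>.\<close>

lemma complemented_contains_v_or_orthogonal:
  assumes simple: "simple_cstar TYPE('a)" and outer: "outer_action \<alpha>"
    and L: "L \<in> complemented_subcorrespondences rmul ip lmul"
  shows "v g \<in> L \<or> v g \<in> orth_complement ip L"
proof -
  let ?M = "orth_complement ip L"
  have sub: "0 \<in> L" "\<And>x y. x \<in> L \<Longrightarrow> y \<in> L \<Longrightarrow> x + y \<in> L" "\<And>c x. x \<in> L \<Longrightarrow> c *\<^sub>C x \<in> L"
    "\<And>a x. x \<in> L \<Longrightarrow> lmul a x \<in> L" "\<And>a x. x \<in> L \<Longrightarrow> rmul x a \<in> L"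
    using L by (auto simp: complemented_subcorrespondences_def subcorrespondence_def complex_subspace_def)
  obtain x y where xy: "x \<in> L" "y \<in> ?M" "v g = x + y"
    using L unfolding complemented_subcorrespondences_def mem_Collect_eq by meson
  have inter: "lmul a x = rmul x (\<alpha> (- g) a)" for a
  proof -
    let ?b = "\<alpha> (- g) a"
    define d where "d = lmul a x - rmul x ?b"
    have dL: "d \<in> L"
      using sub(2)[OF sub(4)[OF xy(1), of a] sub(3)[OF sub(5)[OF xy(1), of ?b], of "-1"]] by (simp add: d_def)
    have "lmul a x + lmul a y = rmul x ?b + rmul y ?b"
      using lmul_v[of a g] by (simp add: xy(3) lmul_add_right rmul_add_left)
    then have "d = rmul y ?b - lmul a y" by (simp add: d_def algebra_simps)
    then have "ip d d = ip d y * ?b - ip (lmul (star a) d) y"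
      by (metis ip_diff_right ip_rmul_right lmul_adjoint')
    also have "\<dots> = 0" using xy(2) dL sub(4) by (simp add: orth_complement_def)
    finally show ?thesis using ip_self_eq_0[of d] by (simp add: d_def)
  qed
  have t: "ip (v h) x * \<alpha> (- g) a = \<alpha> (- h) a * ip (v h) x" for h a
    using ip_v_lmul[of h a x] by (simp add: inter ip_rmul_right)
  have off: "ip (v h) x = 0" if "h \<noteq> g" for h
    using outer_intertwiner_zero[OF simple action outer _ t] that by metis
  have "ip y x = 0" using xy(1,2) by (auto simp: orth_complement_def intro: ip_orthogonal_swap)
  then have txx: "ip (v g) x = ip x x" by (simp add: xy(3) ip_add_left)
  have "\<exists>r. ip (v g) x = of_real r"
  proof (rule simple_central_self_adjoint[OF simple])
    show "ip (v g) x * b = b * ip (v g) x" for b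
      using t[of g "\<alpha> g b"] by (simp add: act_simps)
    show "star (ip (v g) x) = ip (v g) x" unfolding txx by (rule star_ip)
  qed
  then obtain r where r: "ip (v g) x = of_real r" by blast
  define u where "u = x - r *\<^sub>R v g"
  have "ip (v h) u = 0" for h
    using off[of h] r by (simp add: u_def ip_diff_right ip_scaleR_right ip_v_v of_real_def)
  \<comment> \<open>A vector without nonzero coordinates is orthogonal to itself.\<close>
  then have "u \<in> supported_on {}" "u \<in> supported_on (- {})" by (simp_all add: supported_on_def)
  then have "ip u u = 0" by (rule supported_on_orthogonal)
  then have xr: "x = r *\<^sub>R v g" using ip_self_eq_0[of u] by (simp add: u_def)
  show ?thesis
  proof (cases "r = 0")
    case True
    then have "v g = y" using xy(3) xr by simp
    then show ?thesis using xy(2) by simp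
  next
    case False
    have "(1 / r) *\<^sub>R x \<in> L" unfolding scaleR_scaleC by (rule sub(3)[OF xy(1)])
    moreover have "(1 / r) *\<^sub>R x = v g" unfolding xr using False by simp
    ultimately show ?thesis by simp
  qed
qed

lemma complemented_eq_supported_on:
  assumes simple: "simple_cstar TYPE('a)" and outer: "outer_action \<alpha>"
    and L: "L \<in> complemented_subcorrespondences rmul ip lmul"
  shows "L = supported_on {g. v g \<in> L}"
proof
  have sub: "subcorrespondence rmul lmul L" using L by (simp add: complemented_subcorrespondences_def)
  show "L \<subseteq> supported_on {g. v g \<in> L}"
  proof
    fix z assume z: "z \<in> L"
    have "ip (v g) z = 0" if "v g \<notin> L" for g
    proof -
      have "v g \<in> orth_complement ip L"
        using complemented_contains_v_or_orthogonal[OF simple outer L, of g] that by simp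
      then have "ip z (v g) = 0" using z by (simp add: orth_complement_def)
      then show ?thesis by (rule ip_orthogonal_swap)
    qed
    then show "z \<in> supported_on {g. v g \<in> L}" by (simp add: supported_on_def)
  qed
  show "supported_on {g. v g \<in> L} \<subseteq> L"
    unfolding supported_on_closure
    by (rule closure_minimal[OF fin_span_subset[OF sub]]) (use sub in \<open>simp_all add: subcorrespondence_def\<close>)
qed

end

theorem proposition3p8:
  fixes \<alpha> :: "'g::{group_add, countable} \<Rightarrow> 'a::unital_cstar_algebra \<Rightarrow> 'a"
    and rmul :: "'h::complex_banach \<Rightarrow> 'a \<Rightarrow> 'h"
    and ip :: "'h \<Rightarrow> 'h \<Rightarrow> 'a"
    and lmul :: "'a \<Rightarrow> 'h \<Rightarrow> 'h"
    and \<Lambda> :: "('g, 'a) l2_op \<Rightarrow> 'h"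
  assumes "simple_cstar TYPE('a)"
    and "cstar_action \<alpha>"
    and "outer_action \<alpha>"
    and "crossed_product_completion rmul ip lmul \<alpha> \<Lambda>"
  shows "bij_betw (\<lambda>X. closure (\<Lambda> ` X))
           (replete_closed_bimodules \<alpha>)
           (complemented_subcorrespondences rmul ip lmul)"
proof -
  interpret completed_crossed_product rmul ip lmul \<alpha> \<Lambda>
    using assms(2,4) by (intro completed_crossed_product.intro crossed_product.intro)
  show ?thesis
  proof (rule bij_betw_imageI)
    show "inj_on (\<lambda>X. closure (\<Lambda> ` X)) (replete_closed_bimodules \<alpha>)"
    proof (rule inj_onI)
      fix X Y
      assume X: "X \<in> replete_closed_bimodules \<alpha>" and Y: "Y \<in> replete_closed_bimodules \<alpha>"
        and eq: "closure (\<Lambda> ` X) = closure (\<Lambda> ` Y)"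
      have "supported_on (cp_supp_set X) = supported_on (cp_supp_set Y)"
        using eq replete_closed_bimodule_eq[OF X] replete_closed_bimodule_eq[OF Y] closure_operators_on
        by metis
      then have "cp_supp_set X = cp_supp_set Y" using v_supported_on_iff by blast
      then show "X = Y" using replete_closed_bimodule_eq[OF X] replete_closed_bimodule_eq[OF Y] by simp
    qed
    show "(\<lambda>X. closure (\<Lambda> ` X)) ` replete_closed_bimodules \<alpha> =
        complemented_subcorrespondences rmul ip lmul"
    proof (intro equalityI subsetI)
      fix L assume "L \<in> (\<lambda>X. closure (\<Lambda> ` X)) ` replete_closed_bimodules \<alpha>"
      then obtain X where X: "X \<in> replete_closed_bimodules \<alpha>" "L = closure (\<Lambda> ` X)" by blast
      then have "L = supported_on (cp_supp_set X)"
        using replete_closed_bimodule_eq[OF X(1)] closure_operators_on by metis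
      then show "L \<in> complemented_subcorrespondences rmul ip lmul"
        by (simp add: supported_on_complemented)
    next
      fix L assume "L \<in> complemented_subcorrespondences rmul ip lmul"
      then have "L = closure (\<Lambda> ` operators_on {g. v g \<in> L})"
        using complemented_eq_supported_on[OF assms(1,3)] closure_operators_on by simp
      then show "L \<in> (\<lambda>X. closure (\<Lambda> ` X)) ` replete_closed_bimodules \<alpha>"
        using operators_on_replete_closed by (rule image_eqI)
    qed
  qed
qed

end
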